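(* Let $f$ and $A_0$ be as in the context and, for $\rho>0$, let $\mathcal S(\varphi,\psi)=(\varphi+\rho f(\varphi,\psi),A_0\psi)$. Let $\Phi$ be the flow defined by $\frac{d}{dt}\Phi_t(\varphi)=\overline f(\Phi_t(\varphi))$, $\Phi_0(\varphi)=\varphi$, $\varphi\in\mathcal U$, with $\overline f(\varphi)=\langle f(\varphi,\cdot)\rangle$. There exist $\rho_*>0$ and a constant $C_9$, independent of $\rho$, such that for all $\rho\in(0,\rho_* )$, all $n\in\mathbb N$ and all $\varphi\in\mathcal U$ $$\bigl|\bigl\langle(\mathcal S^n)_\varphi(\varphi,\cdot)-\Phi_{n\rho}(\varphi)\bigr\rangle\bigr|\le C_9\,\rho,\qquad \bigl\langle\bigl((\mathcal S^n)_\varphi(\varphi,\cdot)-\Phi_{n\rho}(\varphi)\bigr)^2\bigr\rangle\le C_9\,\rho .$$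
   Context: $\mathbb T=\mathbb R/2\pi\mathbb Z$. $A_0$ is an Anosov (hyperbolic linear) automorphism of $\mathbb T^2$. $\langle g\rangle=\int_{\mathbb T^2}g(\psi)\,d\psi/(2\pi)^2$. The subscript $\varphi$ denotes the first component of a map. For $\alpha\in(0,1]$, $k\ge1$, and $g(\varphi,\psi)$ on $\mathbb T\times\mathbb T^2$: $|g|_\alpha=\sup|g(\varphi,\psi')-g(\varphi,\psi)|/|\psi'-\psi|^\alpha$, and $\mathscr B_{\alpha,k}$ is the space of functions $k$ times continuously differentiable in $\varphi$ with $|||g|||_{\alpha,k}=\sum_{n=0}^k\|\partial_\varphi^ng\|_\infty+\alpha\sum_{n=0}^{k-1}|\partial_\varphi^ng|_\alpha<\infty$. Standing assumptions: $f\in\mathscr B_{\alpha_0,6}(\mathbb T\times\mathbb T^2,\mathbb R)$ for some $\alpha_0\in(0,1]$, $|||f|||_{\alpha_0,6}=1$; there is a closed interval $\mathcal U=[\phi_m,\phi_M]\subsetneq\mathbb T$, $\phi_m<\phi_M$ (identified with an interval of $\mathbb R$), with $\Omega=\mathcal U\times\mathbb T^2$, such that $f(\phi_m,\psi)>0>f(\phi_M,\psi)$ for all $\psi$; for every $\psi$ there is a unique $S(\psi)\in\operatorname{int}\mathcal U$ with $f(S(\psi),\psi)=0$; with $S_m=\inf_\psi S$, $S_M=\sup_\psi S$, $\Lambda=[S_m,S_M]\times\mathbb T^2$, one has $\gamma:=-\sup_{\Lambda}\partial_\varphi f>0$. The parametrization of $\mathbb T$ is such that $0\in[S_m,S_M]$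 is the unique zero of $\overline f$ in $\mathcal U$. The parameter $\rho$ is taken smaller than a suitable $\rho_*>0$ depending on $f$, such that in particular $1+\rho\,\partial_\varphi f>0$ on $\Omega$; then $\mathcal S(\Omega)\subset\Omega$ (as a subset of $\mathbb R\times\mathbb T^2$). *)

theory Defs
  imports "HOL-Analysis.Analysis"
begin

text \<open>
  The tori \<open>T = R/2\<pi>Z\<close> and \<open>T\<^sup>2\<close> are represented by their universal covers: a function on
  \<open>T \<times> T\<^sup>2\<close> is a function on \<open>R \<times> R\<^sup>2\<close> that is \<open>2\<pi>\<close>-periodic in each of its three real arguments.
\<close>

definition torus_periodic :: "(real \<Rightarrow> real^2 \<Rightarrow> real) \<Rightarrow> bool" where
  "torus_periodic g \<longleftrightarrow>
     (\<forall>x \<psi>. g (x + 2 * pi) \<psi> = g x \<psi>) \<and>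
     (\<forall>x \<psi> i. g x (\<psi> + axis i (2 * pi)) = g x \<psi>)"

text \<open>
  The automorphism of \<open>T\<^sup>2\<close> is given by a matrix that is invertible over the integers; hyperbolicity
  is the absence of complex eigenvalues on the unit circle.
\<close>

definition hyperbolic_automorphism :: "int^2^2 \<Rightarrow> bool" where
  "hyperbolic_automorphism A \<longleftrightarrow>
     invertible A \<and>
     (\<forall>c::complex. \<forall>v::complex^2.
        v \<noteq> 0 \<and> map_matrix of_int A *v v = c *s v \<longrightarrow> cmod c \<noteq> 1)"

definition torus_avg :: "(real^2 \<Rightarrow> real) \<Rightarrow> real" where
  "torus_avg g = (LINT \<psi>:cbox 0 (vec (2 * pi))|lborel. g \<psi>) / (2 * pi)\<^sup>2"

definition dphi :: "nat \<Rightarrow> (real \<Rightarrow> real^2 \<Rightarrow> real) \<Rightarrow> real \<Rightarrow> real^2 \<Rightarrow> real" where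
  "dphi n g x \<psi> = (deriv ^^ n) (\<lambda>y. g y \<psi>) x"

definition Ck_phi :: "nat \<Rightarrow> (real \<Rightarrow> real^2 \<Rightarrow> real) \<Rightarrow> bool" where
  "Ck_phi k g \<longleftrightarrow>
     (\<forall>\<psi>. (\<forall>n<k. (\<lambda>x. dphi n g x \<psi>) differentiable_on UNIV) \<and>
          continuous_on UNIV (\<lambda>x. dphi k g x \<psi>))"

text \<open>The (semi)norms take values in \<^typ>\<open>ennreal\<close>, so that they are meaningful before finiteness is known.\<close>

definition sup_nrm :: "(real \<Rightarrow> real^2 \<Rightarrow> real) \<Rightarrow> ennreal" where
  "sup_nrm g = (SUP (x, \<psi>) \<in> UNIV. ennreal \<bar>g x \<psi>\<bar>)"

text \<open>
  For periodic \<open>g\<close> the supremum over the cover agrees with the one formed with the distance of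
  \<open>T\<^sup>2\<close>: the latter is the minimum of the Euclidean distances of lifts.
\<close>

definition holder_seminorm :: "real \<Rightarrow> (real \<Rightarrow> real^2 \<Rightarrow> real) \<Rightarrow> ennreal" where
  "holder_seminorm \<alpha> g =
     (SUP (x, \<psi>, \<psi>') \<in> {(x, \<psi>, \<psi>'). \<psi> \<noteq> \<psi>'}.
        ennreal (\<bar>g x \<psi>' - g x \<psi>\<bar> / norm (\<psi>' - \<psi>) powr \<alpha>))"

definition B_norm :: "real \<Rightarrow> nat \<Rightarrow> (real \<Rightarrow> real^2 \<Rightarrow> real) \<Rightarrow> ennreal" where
  "B_norm \<alpha> k g =
     (\<Sum>n\<le>k. sup_nrm (dphi n g)) + ennreal \<alpha> * (\<Sum>n<k. holder_seminorm \<alpha> (dphi n g))"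

definition B_space :: "real \<Rightarrow> nat \<Rightarrow> (real \<Rightarrow> real^2 \<Rightarrow> real) set" where
  "B_space \<alpha> k = {g. torus_periodic g \<and> Ck_phi k g \<and> B_norm \<alpha> k g < \<infinity>}"

definition avg_field :: "(real \<Rightarrow> real^2 \<Rightarrow> real) \<Rightarrow> real \<Rightarrow> real" where
  "avg_field f x = torus_avg (\<lambda>\<psi>. f x \<psi>)"

definition skew_map ::
  "(real \<Rightarrow> real^2 \<Rightarrow> real) \<Rightarrow> int^2^2 \<Rightarrow> real \<Rightarrow> real \<times> (real^2) \<Rightarrow> real \<times> (real^2)" where
  "skew_map f A \<rho> = (\<lambda>(x, \<psi>). (x + \<rho> * f x \<psi>, map_matrix of_int A *v \<psi>))"

text \<open>
  Only forward times occur; the interval \<open>U\<close> is forward (but in general not backward) invariant.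
\<close>

definition forward_flow_on :: "(real \<Rightarrow> real) \<Rightarrow> real set \<Rightarrow> (real \<Rightarrow> real \<Rightarrow> real) \<Rightarrow> bool" where
  "forward_flow_on v U \<Phi> \<longleftrightarrow>
     (\<forall>x\<in>U. \<Phi> 0 x = x \<and>
        (\<forall>t\<ge>0. ((\<lambda>s. \<Phi> s x) has_real_derivative v (\<Phi> t x)) (at t within {0..})))"

end

theory Submission
  imports Defs
begin

text \<open>
  Write \<open>u\<close> for the averaged field and \<open>E x = x + \<rho> u x\<close>. For \<open>V = F \<circ> E\<^sup>s\<close> with \<open>F\<close> the identity or the
  square, the mean of \<open>F\<close> along the slow variable differs from \<open>F \<circ> E\<^sup>n\<close> by a telescoping sum whose
  terms are, up to \<open>O(\<rho>\<^sup>2)\<close>, \<open>\<rho>\<close> times the mean of \<open>V' \<cdot> (f - u)\<close> along the orbit. The last mean is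
  itself \<open>O(\<rho>)\<close>: one moves the slow variable back in time step by step, each step costing \<open>\<rho>\<close> times a
  correlation that decays exponentially, since the slow variable is regular along unstable
  directions. Both bounds carry a factor \<open>sup \<bar>V'\<bar> + Lip V'\<close>, which decays like \<open>exp (- c \<rho> s)\<close> because
  the averaged dynamics contracts to its attracting zero, so the sum is \<open>O(\<rho>)\<close> uniformly in \<open>n\<close>.
\<close>

section \<open>Averages over the torus\<close>

text \<open>The second bound allows deviations from the flow of order sqrt \<rho>, and a pathwise
  comparison of that accuracy would give the mean only to order sqrt \<rho>. Hence means of
  \<open>F\<close> are compared, so that the first-order term can cancel. The mean square then needs
  no further dynamics: with \<open>e\<close> the Euler value and \<open>y\<close> the flow value,
  the mean of \<open>(X - y)^2\<close> is the error of the mean of \<open>X^2\<close> against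
  \<open>e^2\<close>, minus \<open>2 * y\<close> times the error of the mean of \<open>X\<close>
  against \<open>e\<close>, plus \<open>(y - e)^2\<close>. Two obstacles shape the rest. As a
  function of the initial fast point, the slow variable at time \<open>k\<close> is controlled only
  with a Hoelder constant of order \<open>\<bar>l\<bar> ^ k\<close> to the power \<alpha>. However,
  that constant carries a factor \<rho>, and only unstable displacements of the initial point are
  ever used, which the remaining fast steps make long. Moreover the averaged field may be increasing
  away from its zero, so the Euler map need not contract everywhere. Its orbits are monotone in a
  bounded interval, so the expansion collected there costs one constant factor.\<close>

lemma continuous_on_uncurry:
  assumes "continuous_on UNIV (\<lambda>(x, y). G x y)" "continuous_on S g" "continuous_on S h"
  shows "continuous_on S (\<lambda>s. G (g s) (h s))"
  using continuous_on_compose2[OF assms(1) continuous_on_Pair[OF assms(2,3)]] by simp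

definition torus_fun :: "(real^2 \<Rightarrow> real) \<Rightarrow> bool" where
  "torus_fun g \<longleftrightarrow> continuous_on UNIV g \<and> (\<forall>\<psi> i. g (\<psi> + axis i (2 * pi)) = g \<psi>)"

lemma torus_fun_continuous: "torus_fun g \<Longrightarrow> continuous_on UNIV g"
  and torus_fun_periodic: "torus_fun g \<Longrightarrow> g (\<psi> + axis i (2 * pi)) = g \<psi>"
  by (auto simp: torus_fun_def)

lemma torus_fun_periodic_int:
  assumes "torus_fun g"
  shows "g (\<psi> + axis i (2 * pi * real_of_int m)) = g \<psi>"
proof -
  have nat: "g (\<psi> + axis i (2 * pi * real n)) = g \<psi>" for n \<psi>
  proof (induction n arbitrary: \<psi>)
    case 0
    show ?case by (simp add: axis_eq_0_iff[THEN iffD2])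
  next
    case (Suc n)
    have "\<psi> + axis i (2 * pi * real (Suc n)) = (\<psi> + axis i (2 * pi * real n)) + axis i (2 * pi)"
      by (simp add: vec_eq_iff axis_def algebra_simps)
    then show ?case using Suc torus_fun_periodic[OF assms] by metis
  qed
  show ?thesis
  proof (cases "m \<ge> 0")
    case True
    then show ?thesis using nat[of \<psi> "nat m"] by simp
  next
    case False
    define \<psi>' where "\<psi>' = \<psi> + axis i (2 * pi * real_of_int m)"
    have "\<psi> = \<psi>' + axis i (2 * pi * real (nat (- m)))"
      using False by (simp add: vec_eq_iff axis_def \<psi>'_def)
    then show ?thesis using nat[of \<psi>' "nat (- m)"] \<psi>'_def by metis
  qed
qed

lemma torus_fun_translate:
  assumes "torus_fun g"
  shows "torus_fun (\<lambda>\<psi>. g (\<psi> + a))"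
proof -
  have "g (\<psi> + axis i (2 * pi) + a) = g (\<psi> + a)" for \<psi> i
    using torus_fun_periodic[OF assms, of "\<psi> + a" i] by (simp add: algebra_simps)
  moreover have "continuous_on UNIV (\<lambda>\<psi>. g (\<psi> + a))"
    by (rule continuous_on_compose2[OF torus_fun_continuous[OF assms]]) (auto intro!: continuous_intros)
  ultimately show ?thesis by (simp add: torus_fun_def)
qed

text \<open>Passes from the Lebesgue integral of the definition to the gauge integral, in which
  boxes are cut and the order of integration is exchanged below.\<close>

lemma torus_avg_eq_integral:
  assumes "continuous_on UNIV g"
  shows "torus_avg g = integral (cbox 0 (vec (2 * pi))) g / (2 * pi)\<^sup>2"
proof -
  have "continuous_on (cbox 0 (vec (2 * pi))) g"
    using assms continuous_on_subset by blast
  then have "set_integrable lborel (cbox 0 (vec (2 * pi))) g"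
    unfolding set_integrable_def by (intro borel_integrable_compact) auto
  then show ?thesis
    by (simp add: torus_avg_def set_borel_integral_eq_integral)
qed

lemma measure_torus_box: "measure lborel (cbox 0 (vec (2 * pi)) :: (real^2) set) = (2 * pi)\<^sup>2"
proof -
  have "measure lborel (cbox 0 (vec (2 * pi)) :: (real^2) set) = (\<Prod>i\<in>(UNIV::2 set). 2 * pi)"
    by (subst content_cbox_cart) (auto simp: interval_eq_empty_cart not_less)
  then show ?thesis by simp
qed

lemma continuous_integrable_torus:
  fixes g :: "real^2 \<Rightarrow> real"
  assumes "continuous_on UNIV g"
  shows "g integrable_on cbox 0 (vec (2 * pi))"
  using assms continuous_on_subset integrable_continuous by blast

lemma torus_avg_const [simp]: "torus_avg (\<lambda>_. c) = c"
  by (simp add: torus_avg_eq_integral measure_torus_box)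

lemma torus_avg_cmult: "torus_avg (\<lambda>\<psi>. c * g \<psi>) = c * torus_avg g"
  by (simp add: torus_avg_def)

lemma torus_avg_add:
  assumes "continuous_on UNIV g" "continuous_on UNIV h"
  shows "torus_avg (\<lambda>\<psi>. g \<psi> + h \<psi>) = torus_avg g + torus_avg h"
  using assms
  by (simp add: torus_avg_eq_integral continuous_on_add integral_add continuous_integrable_torus add_divide_distrib)

lemma torus_avg_diff:
  assumes "continuous_on UNIV g" "continuous_on UNIV h"
  shows "torus_avg (\<lambda>\<psi>. g \<psi> - h \<psi>) = torus_avg g - torus_avg h"
  using assms
  by (simp add: torus_avg_eq_integral continuous_on_diff integral_diff continuous_integrable_torus diff_divide_distrib)

lemma torus_avg_mono:
  assumes "continuous_on UNIV g" "continuous_on UNIV h" "\<And>\<psi>. \<psi> \<in> cbox 0 (vec (2 * pi)) \<Longrightarrow> g \<psi> \<le> h \<psi>"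
  shows "torus_avg g \<le> torus_avg h"
  using assms
  by (auto simp: torus_avg_eq_integral intro!: divide_right_mono integral_le continuous_integrable_torus)

lemma torus_avg_abs_le:
  assumes "continuous_on UNIV g" "\<And>\<psi>. \<psi> \<in> cbox 0 (vec (2 * pi)) \<Longrightarrow> \<bar>g \<psi>\<bar> \<le> B"
  shows "\<bar>torus_avg g\<bar> \<le> B"
proof -
  have "torus_avg g \<le> torus_avg (\<lambda>_. B)" "torus_avg (\<lambda>_. - B) \<le> torus_avg g"
    using assms by (auto intro!: torus_avg_mono simp: abs_le_iff minus_le_iff simp del: torus_avg_const)
  then show ?thesis by simp
qed

lemma torus_avg_abs_diff_le:
  assumes "continuous_on UNIV g" "continuous_on UNIV h" "\<And>\<psi>. \<psi> \<in> cbox 0 (vec (2 * pi)) \<Longrightarrow> \<bar>g \<psi> - h \<psi>\<bar> \<le> B"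
  shows "\<bar>torus_avg g - torus_avg h\<bar> \<le> B"
  using torus_avg_abs_le[of "\<lambda>\<psi>. g \<psi> - h \<psi>" B] assms
  by (simp add: torus_avg_diff continuous_on_diff)

lemma torus_avg_pos:
  assumes "continuous_on UNIV g" "\<And>\<psi>. g \<psi> > 0"
  shows "torus_avg g > 0"
proof -
  let ?B = "cbox 0 (vec (2 * pi)) :: (real^2) set"
  have "compact ?B" "?B \<noteq> {}" "continuous_on ?B g"
    using assms(1) continuous_on_subset by (auto simp: interval_eq_empty_cart not_less)
  then obtain x where x: "\<And>y. y \<in> ?B \<Longrightarrow> g x \<le> g y"
    using continuous_attains_inf[of ?B g] by blast
  have "integral ?B (\<lambda>_. g x) \<le> integral ?B g"
    using x assms(1) by (intro integral_le continuous_integrable_torus) auto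
  moreover have "integral ?B (\<lambda>_. g x) > 0"
    using assms(2)[of x] by (simp add: measure_torus_box)
  ultimately show ?thesis using assms(1) by (simp add: torus_avg_eq_integral)
qed

text \<open>The shifted square loses the slab \<open>cbox 0 b'\<close> of width \<open>t\<close> at
  one face and gains its translate by 2 pi at the opposite face, over which a periodic function has
  the same integral.\<close>

lemma torus_avg_shift_axis_small:
  assumes "torus_fun g" "0 \<le> t" "t \<le> 2 * pi"
  shows "torus_avg (\<lambda>\<psi>. g (\<psi> + axis i t)) = torus_avg g"
proof -
  define b :: "real^2" where "b = vec (2 * pi)"
  define b' :: "real^2" where "b' = (\<chi> j. if j = i then t else 2 * pi)"
  have int: "g integrable_on cbox x y" for x y
    using torus_fun_continuous[OF assms(1)] continuous_on_subset integrable_continuous by blast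
  have k: "axis i 1 \<in> (Basis :: (real^2) set)" by (simp add: axis_in_Basis_iff)
  have "integral (cbox 0 b) g = integral (cbox 0 b \<inter> {x. x $ i \<le> t}) g
      + integral (cbox 0 b \<inter> {x. x $ i \<ge> t}) g"
    using integral_split[OF int k] by (simp add: inner_axis)
  also have "cbox 0 b \<inter> {x. x $ i \<le> t} = cbox 0 b'"
    using assms(2,3) exhaust_2[of i] by (auto simp: set_eq_iff mem_box_cart forall_2 b_def b'_def inner_axis)
  also have "cbox 0 b \<inter> {x. x $ i \<ge> t} = cbox (axis i t) b"
    using assms(2,3) exhaust_2[of i] by (auto simp: set_eq_iff mem_box_cart forall_2 b_def axis_def inner_axis)
  finally have 1: "integral (cbox 0 b) g = integral (cbox 0 b') g + integral (cbox (axis i t) b) g" .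
  have "integral (cbox (axis i t) (b + axis i t)) g
      = integral (cbox (axis i t) (b + axis i t) \<inter> {x. x $ i \<le> 2 * pi}) g
      + integral (cbox (axis i t) (b + axis i t) \<inter> {x. x $ i \<ge> 2 * pi}) g"
    using integral_split[OF int k] by (simp add: inner_axis)
  also have "cbox (axis i t) (b + axis i t) \<inter> {x. x $ i \<le> 2 * pi} = cbox (axis i t) b"
    using assms(2,3) exhaust_2[of i] by (auto simp: set_eq_iff mem_box_cart forall_2 b_def axis_def inner_axis)
  also have "cbox (axis i t) (b + axis i t) \<inter> {x. x $ i \<ge> 2 * pi}
      = cbox (0 + axis i (2 * pi)) (b' + axis i (2 * pi))"
    using assms(2,3) exhaust_2[of i] by (auto simp: set_eq_iff mem_box_cart forall_2 b_def b'_def axis_def inner_axis)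
  also have "integral \<dots> g = integral (cbox 0 b') (g \<circ> ((+) (axis i (2 * pi))))"
    by (rule integral_shift_cbox_plus[symmetric])
  also have "g \<circ> ((+) (axis i (2 * pi))) = g"
    using torus_fun_periodic[OF assms(1)] by (auto simp: add.commute)
  finally have "integral (cbox (axis i t) (b + axis i t)) g = integral (cbox 0 b) g"
    using 1 by simp
  moreover have "integral (cbox 0 b) (\<lambda>\<psi>. g (\<psi> + axis i t)) = integral (cbox (axis i t) (b + axis i t)) g"
    using integral_shift_cbox_plus[of 0 b g "axis i t"] by (simp add: o_def add.commute)
  ultimately show ?thesis
    using torus_fun_continuous[OF assms(1)] torus_fun_continuous[OF torus_fun_translate[OF assms(1)]]
    by (simp add: torus_avg_eq_integral b_def)
qed

lemma torus_avg_shift_axis: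
  assumes "torus_fun g"
  shows "torus_avg (\<lambda>\<psi>. g (\<psi> + axis i t)) = torus_avg g"
proof -
  define m where "m = \<lfloor>t / (2 * pi)\<rfloor>"
  define t' where "t' = t - 2 * pi * m"
  have "real_of_int m \<le> t / (2 * pi)" "t / (2 * pi) \<le> real_of_int m + 1"
    unfolding m_def by linarith+
  then have t': "0 \<le> t'" "t' \<le> 2 * pi"
    by (simp_all add: t'_def field_simps)
  have "g (\<psi> + axis i t) = g (\<psi> + axis i t')" for \<psi>
  proof -
    have "\<psi> + axis i t = (\<psi> + axis i t') + axis i (2 * pi * m)"
      by (simp add: vec_eq_iff axis_def t'_def)
    then show ?thesis using torus_fun_periodic_int[OF assms] by metis
  qed
  then show ?thesis using torus_avg_shift_axis_small[OF assms t'] by simp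
qed

lemma torus_avg_translate:
  assumes "torus_fun g"
  shows "torus_avg (\<lambda>\<psi>. g (\<psi> + a)) = torus_avg g"
proof -
  have "a = axis 1 (a$1) + axis 2 (a$2)"
    by (simp add: vec_eq_iff axis_def forall_2)
  then have "torus_avg (\<lambda>\<psi>. g (\<psi> + a)) = torus_avg (\<lambda>\<psi>. g ((\<psi> + axis 1 (a$1)) + axis 2 (a$2)))"
    by (metis add.assoc)
  also have "\<dots> = torus_avg (\<lambda>\<psi>. g (\<psi> + axis 2 (a$2)))"
    by (rule torus_avg_shift_axis[OF torus_fun_translate[OF assms]])
  also have "\<dots> = torus_avg g" by (rule torus_avg_shift_axis[OF assms])
  finally show ?thesis .
qed

lemma continuous_on_torus_avg:
  assumes "continuous_on UNIV (\<lambda>(x, \<psi>). G x \<psi>)"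
  shows "continuous_on UNIV (\<lambda>x. torus_avg (G x))"
proof -
  have "continuous_on UNIV (G x)" for x
    by (rule continuous_on_uncurry[OF assms]) (auto intro: continuous_intros)
  moreover have "continuous_on UNIV (\<lambda>x. integral (cbox 0 (vec (2 * pi))) (G x))"
    by (rule integral_continuous_on_param) (rule continuous_on_subset[OF assms], auto)
  ultimately show ?thesis
    by (simp add: torus_avg_eq_integral continuous_on_divide)
qed

lemma torus_avg_swap:
  assumes "continuous_on UNIV (\<lambda>(\<xi>, \<psi>). G \<xi> \<psi>)"
  shows "torus_avg (\<lambda>\<xi>. torus_avg (G \<xi>)) = torus_avg (\<lambda>\<psi>. torus_avg (\<lambda>\<xi>. G \<xi> \<psi>))"
proof -
  have c1: "continuous_on UNIV (G x)" for x
    by (rule continuous_on_uncurry[OF assms]) (auto intro: continuous_intros)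
  have c2: "continuous_on UNIV (\<lambda>x. G x y)" for y
    by (rule continuous_on_uncurry[OF assms]) (auto intro: continuous_intros)
  have "continuous_on UNIV (\<lambda>(\<psi>, \<xi>). G \<xi> \<psi>)"
    unfolding case_prod_unfold
    by (rule continuous_on_uncurry[OF assms]) (auto intro: continuous_intros)
  then have "continuous_on UNIV (\<lambda>\<psi>. torus_avg (\<lambda>\<xi>. G \<xi> \<psi>))"
    by (rule continuous_on_torus_avg)
  moreover note continuous_on_torus_avg[OF assms]
  moreover have "integral (cbox 0 (vec (2 * pi))) (\<lambda>x. integral (cbox 0 (vec (2 * pi))) (G x)) =
           integral (cbox 0 (vec (2 * pi))) (\<lambda>y. integral (cbox 0 (vec (2 * pi))) (\<lambda>x. G x y))"
    by (rule integral_swap_continuous) (rule continuous_on_subset[OF assms], auto)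
  ultimately show ?thesis
    by (simp add: torus_avg_eq_integral c1 c2)
qed

section \<open>Decay of correlations for hyperbolic automorphisms\<close>

text \<open>\<open>Pu\<close> and \<open>Ps\<close> are the projections to the unstable and the
  stable line. \<open>contracting\<close> records that the determinant is 1 or -1, and
  \<open>lattice\<close> is the only trace of the integer entries: \<open>T\<close> preserves the
  period lattice, so composing with \<open>T\<close> keeps functions on the torus.\<close>

locale torus_splitting =
  fixes T Pu Ps :: "real^2 \<Rightarrow> real^2" and l m :: real
  assumes linear_T: "linear T" and linear_Pu: "linear Pu" and linear_Ps: "linear Ps"
    and splitting: "Pu x + Ps x = x"
    and T_Pu: "T (Pu x) = l *\<^sub>R Pu x"
    and T_Ps: "T (Ps x) = m *\<^sub>R Ps x"
    and expanding: "\<bar>l\<bar> > 1" and contracting: "\<bar>m\<bar> = 1 / \<bar>l\<bar>"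
    and lattice: "torus_fun g \<Longrightarrow> g (\<psi> + T (axis i (2 * pi))) = g \<psi>"
begin

lemma continuous_on_T: "continuous_on S T"
  using linear_T linear_continuous_on linear_linear by blast

lemma surj_T: "\<exists>y. T y = x"
proof -
  have "l \<noteq> 0" "m \<noteq> 0" using expanding contracting by auto
  then have "T ((1 / l) *\<^sub>R Pu x + (1 / m) *\<^sub>R Ps x) = Pu x + Ps x"
    by (simp add: linear_add[OF linear_T] linear_cmul[OF linear_T] T_Pu T_Ps)
  then show ?thesis using splitting by metis
qed

lemma torus_fun_T:
  assumes "torus_fun g"
  shows "torus_fun (\<lambda>\<psi>. g (T \<psi>))"
  unfolding torus_fun_def
  using continuous_on_compose2[OF torus_fun_continuous[OF assms] continuous_on_T[of UNIV]]
    lattice[OF assms] by (simp add: linear_add[OF linear_T])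

lemma linear_T_pow: "linear (T ^^ k)"
proof (induction k)
  case 0
  show ?case by (simp add: linear_id id_def[symmetric])
next
  case (Suc k)
  then show ?case using linear_compose linear_T by (auto simp: o_def)
qed

lemma continuous_on_T_pow: "continuous_on S (T ^^ k)"
  using linear_T_pow linear_continuous_on linear_linear by blast

lemma T_pow_Pu: "(T ^^ k) (Pu x) = l ^ k *\<^sub>R Pu x"
  by (induction k) (simp_all add: linear_cmul[OF linear_T] T_Pu)

lemma T_pow_Ps: "(T ^^ k) (Ps x) = m ^ k *\<^sub>R Ps x"
  by (induction k) (simp_all add: linear_cmul[OF linear_T] T_Ps)

lemma torus_fun_T_pow: "torus_fun g \<Longrightarrow> torus_fun (\<lambda>\<psi>. g ((T ^^ k) \<psi>))"
  by (induction k arbitrary: g) (auto dest: torus_fun_T)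

text \<open>The average of \<open>g (T \<psi> + a)\<close> over \<open>\<psi>\<close> does not depend on \<open>a\<close>, because \<open>T\<close> is onto;
  averaging it over \<open>a\<close> as well gives the average of \<open>g\<close>.\<close>

lemma torus_avg_T:
  assumes "torus_fun g"
  shows "torus_avg (\<lambda>\<psi>. g (T \<psi>)) = torus_avg g"
proof -
  have "torus_avg (\<lambda>\<psi>. g (T \<psi> + a)) = torus_avg (\<lambda>\<psi>. g (T \<psi>))" for a
  proof -
    obtain b where "T b = a" using surj_T by blast
    then show ?thesis
      using torus_avg_translate[OF torus_fun_T[OF assms], of b] by (simp add: linear_add[OF linear_T])
  qed
  then have "torus_avg (\<lambda>\<psi>. g (T \<psi>)) = torus_avg (\<lambda>a. torus_avg (\<lambda>\<psi>. g (T \<psi> + a)))"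
    by simp
  also have "\<dots> = torus_avg (\<lambda>\<psi>. torus_avg (\<lambda>a. g (T \<psi> + a)))"
    by (rule torus_avg_swap) (auto simp: case_prod_unfold
        intro!: continuous_on_compose2[OF torus_fun_continuous[OF assms]] continuous_intros
        continuous_on_compose2[OF continuous_on_T[of UNIV]])
  also have "\<dots> = torus_avg g"
    using torus_avg_translate[OF assms] by (simp add: add.commute[of "T _"])
  finally show ?thesis .
qed

lemma torus_avg_T_pow: "torus_fun g \<Longrightarrow> torus_avg (\<lambda>\<psi>. g ((T ^^ k) \<psi>)) = torus_avg g"
proof (induction k arbitrary: g)
  case 0
  show ?case by simp
next
  case (Suc k)
  have "torus_avg (\<lambda>\<psi>. g (T ((T ^^ k) \<psi>))) = torus_avg (\<lambda>\<psi>. g (T \<psi>))"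
    by (rule Suc.IH[OF torus_fun_T[OF Suc.prems]])
  also have "\<dots> = torus_avg g" by (rule torus_avg_T[OF Suc.prems])
  finally show ?case by simp
qed

text \<open>Points of the fundamental square have l1 norm at most 4 pi. The sum of the operator
  norms lets one constant serve both components.\<close>

definition split_const :: real where
  "split_const = 4 * pi * (onorm Pu + onorm Ps)"

lemma split_const_bound:
  assumes "\<xi> \<in> cbox 0 (vec (2 * pi))"
  shows "norm (Pu \<xi>) \<le> split_const" "norm (Ps \<xi>) \<le> split_const"
proof -
  have bl: "bounded_linear Pu" "bounded_linear Ps"
    using linear_Pu linear_Ps by (simp_all add: linear_linear)
  have "norm \<xi> \<le> \<bar>\<xi> $ 1\<bar> + \<bar>\<xi> $ 2\<bar>"
    using norm_le_l1_cart[of \<xi>] by (simp add: sum_2)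
  also have "\<dots> \<le> 4 * pi" using assms by (auto simp: mem_box_cart forall_2)
  finally have n: "norm \<xi> \<le> 4 * pi" .
  have "norm (Pu \<xi>) \<le> onorm Pu * norm \<xi>" "norm (Ps \<xi>) \<le> onorm Ps * norm \<xi>"
    using onorm bl by blast+
  moreover have "onorm Pu * norm \<xi> \<le> onorm Pu * (4 * pi)" "onorm Ps * norm \<xi> \<le> onorm Ps * (4 * pi)"
    using n bl onorm_pos_le by (auto intro!: mult_left_mono)
  moreover have "0 \<le> onorm Pu * (4 * pi)" "0 \<le> onorm Ps * (4 * pi)"
    using bl onorm_pos_le by (auto intro!: mult_nonneg_nonneg)
  moreover have "split_const = onorm Pu * (4 * pi) + onorm Ps * (4 * pi)"
    by (simp add: split_const_def algebra_simps)
  ultimately show "norm (Pu \<xi>) \<le> split_const" "norm (Ps \<xi>) \<le> split_const"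
    by linarith+
qed

lemma split_const_nonneg: "0 \<le> split_const"
  using split_const_bound(1)[of 0] by (simp add: mem_box_cart linear_0[OF linear_Pu])

text \<open>Shifting \<open>\<psi>\<close> by a short unstable vector changes the first argument of \<open>D\<close> little and moves
  the second one by a long unstable vector \<open>l\<^sup>i Pu \<xi>\<close>; this is close to \<open>T\<^sup>i \<xi>\<close>, and the average over
  \<open>\<xi>\<close> of a function at \<open>T\<^sup>i \<xi>\<close> is its full average.\<close>

lemma decorrelation:
  fixes D :: "real^2 \<Rightarrow> real^2 \<Rightarrow> real"
  assumes cont: "continuous_on UNIV (\<lambda>(\<psi>, \<psi>'). D \<psi> \<psi>')"
    and per1: "\<And>\<psi>'. torus_fun (\<lambda>\<psi>. D \<psi> \<psi>')"
    and per2: "\<And>\<psi>. torus_fun (D \<psi>)"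
    and zero: "\<And>\<psi>. torus_avg (D \<psi>) = 0"
    and unst: "\<And>\<psi> \<psi>' z. \<bar>D (\<psi> + Pu z) \<psi>' - D \<psi> \<psi>'\<bar> \<le> K * (\<bar>l\<bar> ^ j * norm (Pu z)) powr \<alpha>"
    and hold: "\<And>\<psi> \<psi>' \<psi>''. \<bar>D \<psi> \<psi>' - D \<psi> \<psi>''\<bar> \<le> K * norm (\<psi>' - \<psi>'') powr \<alpha>"
    and "j \<le> k" "0 \<le> K" "0 < \<alpha>"
  shows "\<bar>torus_avg (\<lambda>\<psi>. D \<psi> ((T ^^ k) \<psi>))\<bar>
    \<le> 2 * K * (split_const * (1 / \<bar>l\<bar>) ^ ((k - j) div 2)) powr \<alpha>"
proof -
  \<comment> \<open>The gap is halved to balance two errors: the shift of the first argument, of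
    order \<open>(1 / \<bar>l\<bar>) ^ (k - j - i)\<close>, and the stable part of
    \<open>T ^^ i\<close>, of order \<open>(1 / \<bar>l\<bar>) ^ i\<close>. Rounding down ensures
    \<open>i \<le> k - j - i\<close>.\<close>
  define i where "i = (k - j) div 2"
  define B where "B = K * (split_const * (1 / \<bar>l\<bar>) ^ i) powr \<alpha>"
  define I where "I = torus_avg (\<lambda>\<psi>. D \<psi> ((T ^^ k) \<psi>))"
  define J where "J = (\<lambda>\<xi>. torus_avg (\<lambda>\<psi>. D \<psi> ((T ^^ k) \<psi> + (T ^^ i) \<xi>)))"
  have l0: "l \<noteq> 0" using expanding by auto
  have T_add: "(T ^^ n) (x + y) = (T ^^ n) x + (T ^^ n) y" for n x y
    by (rule linear_add[OF linear_T_pow])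
  have D_add: "D (\<psi> + axis n (2 * pi)) \<psi>' = D \<psi> \<psi>'" for \<psi> \<psi>' n
    using torus_fun_periodic[OF per1] .
  have tf: "torus_fun (\<lambda>\<psi>. D \<psi> ((T ^^ k) \<psi>))"
    unfolding torus_fun_def
  proof (intro conjI allI)
    show "continuous_on UNIV (\<lambda>\<psi>. D \<psi> ((T ^^ k) \<psi>))"
      by (intro continuous_on_uncurry[OF cont] continuous_on_T_pow continuous_intros)
    show "D (\<psi> + axis n (2 * pi)) ((T ^^ k) (\<psi> + axis n (2 * pi))) = D \<psi> ((T ^^ k) \<psi>)" for \<psi> n
      using torus_fun_periodic[OF torus_fun_T_pow[OF per2]] by (simp add: D_add)
  qed
  have diff: "\<bar>I - J \<xi>\<bar> \<le> 2 * B" if \<xi>: "\<xi> \<in> cbox 0 (vec (2 * pi))" for \<xi>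
  proof -
    \<comment> \<open>Chosen so that \<open>k\<close> steps stretch the displacement
      \<open>Pu z\<close> to \<open>l ^ i *\<^sub>R Pu \<xi>\<close>.\<close>
    define z where "z = (l ^ i / l ^ k) *\<^sub>R \<xi>"
    have Pz: "Pu z = (l ^ i / l ^ k) *\<^sub>R Pu \<xi>"
      by (simp add: z_def linear_cmul[OF linear_Pu])
    have Tz: "(T ^^ k) (Pu z) = l ^ i *\<^sub>R Pu \<xi>"
      using l0 by (simp add: T_pow_Pu) (simp add: Pz)
    have I: "I = torus_avg (\<lambda>\<psi>. D (\<psi> + Pu z) ((T ^^ k) \<psi> + l ^ i *\<^sub>R Pu \<xi>))"
      using torus_avg_translate[OF tf, of "Pu z"] by (simp add: T_add Tz I_def)
    have "k = j + i + (k - j - i)" using \<open>j \<le> k\<close> by (simp add: i_def)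
    then have "\<bar>l\<bar> ^ k = \<bar>l\<bar> ^ j * \<bar>l\<bar> ^ i * \<bar>l\<bar> ^ (k - j - i)"
      by (metis power_add)
    then have "\<bar>l\<bar> ^ j * norm (Pu z) = (1 / \<bar>l\<bar>) ^ (k - j - i) * norm (Pu \<xi>)"
      using l0 by (simp add: Pz power_abs field_simps)
    also have "\<dots> \<le> (1 / \<bar>l\<bar>) ^ i * split_const"
      using expanding split_const_bound(1)[OF \<xi>]
      by (intro mult_mono power_decreasing) (auto simp: i_def)
    finally have u: "(\<bar>l\<bar> ^ j * norm (Pu z)) powr \<alpha> \<le> (split_const * (1 / \<bar>l\<bar>) ^ i) powr \<alpha>"
      using \<open>0 < \<alpha>\<close> by (intro powr_mono2) (auto simp: mult.commute)
    have "(T ^^ i) \<xi> = l ^ i *\<^sub>R Pu \<xi> + m ^ i *\<^sub>R Ps \<xi>"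
      using T_add[of i "Pu \<xi>" "Ps \<xi>"] by (simp add: splitting T_pow_Pu T_pow_Ps)
    then have "norm (l ^ i *\<^sub>R Pu \<xi> - (T ^^ i) \<xi>) = (1 / \<bar>l\<bar>) ^ i * norm (Ps \<xi>)"
      by (simp add: contracting power_abs)
    also have "\<dots> \<le> (1 / \<bar>l\<bar>) ^ i * split_const"
      using split_const_bound(2)[OF \<xi>] by (intro mult_left_mono) auto
    finally have s: "norm (l ^ i *\<^sub>R Pu \<xi> - (T ^^ i) \<xi>) powr \<alpha> \<le> (split_const * (1 / \<bar>l\<bar>) ^ i) powr \<alpha>"
      using \<open>0 < \<alpha>\<close> by (intro powr_mono2) (auto simp: mult.commute)
    show ?thesis unfolding I J_def
    proof (rule torus_avg_abs_diff_le)
      fix \<psi>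
      let ?y = "(T ^^ k) \<psi>"
      have "\<bar>D (\<psi> + Pu z) (?y + l ^ i *\<^sub>R Pu \<xi>) - D \<psi> (?y + l ^ i *\<^sub>R Pu \<xi>)\<bar> \<le> B"
        using order_trans[OF unst mult_left_mono[OF u \<open>0 \<le> K\<close>]] by (simp add: B_def)
      moreover have "\<bar>D \<psi> (?y + l ^ i *\<^sub>R Pu \<xi>) - D \<psi> (?y + (T ^^ i) \<xi>)\<bar> \<le> B"
        using order_trans[OF hold[of \<psi> "?y + l ^ i *\<^sub>R Pu \<xi>" "?y + (T ^^ i) \<xi>"]] mult_left_mono[OF s \<open>0 \<le> K\<close>]
        by (simp add: B_def)
      ultimately show "\<bar>D (\<psi> + Pu z) (?y + l ^ i *\<^sub>R Pu \<xi>) - D \<psi> (?y + (T ^^ i) \<xi>)\<bar> \<le> 2 * B"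
        by linarith
    qed (intro continuous_on_uncurry[OF cont] continuous_on_T_pow continuous_intros)+
  qed
  have c2: "continuous_on UNIV (\<lambda>(\<xi>, \<psi>). D \<psi> ((T ^^ k) \<psi> + (T ^^ i) \<xi>))"
    unfolding case_prod_unfold
    by (intro continuous_on_uncurry[OF cont] continuous_intros
        continuous_on_compose2[OF continuous_on_T_pow[of UNIV]]) auto
  have "torus_avg J = torus_avg (\<lambda>\<psi>. torus_avg (\<lambda>\<xi>. D \<psi> ((T ^^ k) \<psi> + (T ^^ i) \<xi>)))"
    unfolding J_def by (rule torus_avg_swap[OF c2])
  also have "\<dots> = 0"
  proof -
    have "torus_avg (\<lambda>\<xi>. D \<psi> ((T ^^ k) \<psi> + (T ^^ i) \<xi>)) = 0" for \<psi>
      using torus_avg_T_pow[OF torus_fun_translate[OF per2[of \<psi>], of "(T ^^ k) \<psi>"], of i]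
        torus_avg_translate[OF per2[of \<psi>]] by (simp add: add.commute[of "(T ^^ k) \<psi>"] zero)
    then show ?thesis by simp
  qed
  finally have "torus_avg J = 0" .
  moreover have "\<bar>torus_avg (\<lambda>_. I) - torus_avg J\<bar> \<le> 2 * B"
    by (rule torus_avg_abs_diff_le[OF _ _ diff]) (simp_all add: J_def continuous_on_torus_avg[OF c2])
  ultimately show ?thesis by (simp add: I_def B_def i_def mult.assoc)
qed

end

text \<open>Determinant -1 makes the discriminant positive. With determinant 1, non-real roots would
  be conjugate with product 1, hence on the unit circle. So the roots are real, and as their product
  is 1 or -1 and neither has modulus 1, exactly one of them is expanding.\<close>

lemma hyperbolic_eigenvalues:
  assumes "hyperbolic_automorphism A"
  obtains l m :: real where "\<bar>l\<bar> > 1" "\<bar>m\<bar> = 1 / \<bar>l\<bar>"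
    "l + m = of_int (A $ 1 $ 1 + A $ 2 $ 2)"
    "l * m = of_int (A $ 1 $ 1 * A $ 2 $ 2 - A $ 1 $ 2 * A $ 2 $ 1)"
proof -
  define p q r s where "p = A $ 1 $ 1" and "q = A $ 1 $ 2" and "r = A $ 2 $ 1" and "s = A $ 2 $ 2"
  have eig: "cmod c \<noteq> 1" if "v \<noteq> 0" "map_matrix of_int A *v v = c *s v" for c and v :: "complex^2"
    using assms that unfolding hyperbolic_automorphism_def by blast
  obtain A' where "A ** A' = mat 1"
    using assms unfolding hyperbolic_automorphism_def invertible_def by blast
  then have "det A * det A' = 1"
    by (metis det_mul det_I)
  then have det: "p * s - q * r = 1 \<or> p * s - q * r = - 1"
    by (simp add: zmult_eq_1_iff det_2 p_def q_def r_def s_def) blast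
  \<comment> \<open>This makes the vector with entries \<open>c - s\<close> and \<open>r\<close> an
    eigenvector for every root \<open>c\<close> of the characteristic polynomial. If
    \<open>r\<close> vanished, the first basis vector would have eigenvalue \<open>p\<close>, which
    is 1 or -1.\<close>
  have r0: "r \<noteq> 0"
  proof
    assume "r = 0"
    then have "\<bar>p\<bar> = 1" using det by (auto simp: zmult_eq_1_iff zmult_eq_neg1_iff)
    moreover have "cmod (of_int p) \<noteq> 1"
      by (rule eig[of "vector [1, 0]"])
        (use \<open>r = 0\<close> in \<open>auto simp: vec_eq_iff forall_2 matrix_vector_mult_def sum_2 map_matrix_def p_def r_def\<close>)
    ultimately show False by (simp add: of_int_abs[symmetric] del: of_int_abs)
  qed
  have root: "cmod c \<noteq> 1" if "c\<^sup>2 - of_int (p + s) * c + of_int (p * s - q * r) = 0" for c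
  proof (rule eig[of "vector [c - of_int s, of_int r]"])
    show "vector [c - of_int s, of_int r] \<noteq> (0 :: complex^2)"
      using r0 by (auto simp: vec_eq_iff forall_2)
    have "of_int p * (c - of_int s) + of_int q * of_int r = c * (c - of_int s)"
      using that by (simp add: algebra_simps power2_eq_square)
    then show "map_matrix of_int A *v vector [c - of_int s, of_int r] = c *s vector [c - of_int s, of_int r]"
      by (simp add: vec_eq_iff forall_2 matrix_vector_mult_def sum_2 map_matrix_def p_def[symmetric]
          q_def[symmetric] r_def[symmetric] s_def[symmetric] algebra_simps)
  qed
  define t d where "t = real_of_int (p + s)" and "d = real_of_int (p * s - q * r)"
  have d: "d = 1 \<or> d = - 1" using det unfolding d_def by (metis of_int_1 of_int_minus)
  have disc: "t\<^sup>2 - 4 * d \<ge> 0"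
  proof (rule ccontr)
    assume neg: "\<not> t\<^sup>2 - 4 * d \<ge> 0"
    have "d = 1" using d
    proof
      assume "d = - 1" then show ?thesis using neg zero_le_power2[of t] by linarith
    qed
    define w where "w = sqrt (4 - t\<^sup>2)"
    have w: "w\<^sup>2 = 4 - t\<^sup>2" using neg \<open>d = 1\<close> by (simp add: w_def)
    define c where "c = Complex (t / 2) (w / 2)"
    have "cmod c = 1" using w by (simp add: c_def cmod_def power_divide add_divide_distrib[symmetric])
    moreover have "c\<^sup>2 - of_real t * c + of_real d = 0"
      using w \<open>d = 1\<close> by (simp add: c_def complex_eq_iff power2_eq_square algebra_simps)
    ultimately show False using root[of c] by (simp add: t_def d_def)
  qed
  define e where "e = sqrt (t\<^sup>2 - 4 * d)"
  define x y where "x = (t + e) / 2" and "y = (t - e) / 2"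
  have e: "e\<^sup>2 = t\<^sup>2 - 4 * d" using disc by (simp add: e_def)
  have xy: "x + y = t" "x * y = d"
    using e by (simp_all add: x_def y_def field_simps power2_eq_square)
  have "x\<^sup>2 - t * x + d = 0" using xy by (auto simp: algebra_simps power2_eq_square)
  then have "complex_of_real (x\<^sup>2 - t * x + d) = 0" by simp
  then have "\<bar>x\<bar> \<noteq> 1" using root[of "of_real x"] by (simp add: t_def d_def)
  moreover have "\<bar>x\<bar> * \<bar>y\<bar> = 1" using xy d by (auto simp: abs_mult[symmetric])
  ultimately have "\<bar>x\<bar> > 1 \<and> \<bar>y\<bar> = 1 / \<bar>x\<bar> \<or> \<bar>y\<bar> > 1 \<and> \<bar>x\<bar> = 1 / \<bar>y\<bar>"
  proof -
    have 0: "\<bar>x\<bar> > 0" "\<bar>y\<bar> > 0" using \<open>\<bar>x\<bar> * \<bar>y\<bar> = 1\<close> by auto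
    then have eq: "\<bar>y\<bar> = 1 / \<bar>x\<bar>" "\<bar>x\<bar> = 1 / \<bar>y\<bar>"
      using \<open>\<bar>x\<bar> * \<bar>y\<bar> = 1\<close> by (simp_all add: nonzero_eq_divide_eq mult.commute)
    have "\<bar>y\<bar> > 1" if "\<bar>x\<bar> < 1"
      unfolding eq(1) using that 0 by simp
    then show ?thesis using \<open>\<bar>x\<bar> \<noteq> 1\<close> eq by linarith
  qed
  then show ?thesis
    using that[of x y] that[of y x] xy
    by (auto simp: t_def d_def p_def q_def r_def s_def add.commute mult.commute)
qed

text \<open>By the Cayley--Hamilton theorem \<open>(A - m)/(l - m)\<close> and \<open>(l - A)/(l - m)\<close> are the projections to
  the two eigendirections.\<close>

lemma hyperbolic_splitting:
  assumes "hyperbolic_automorphism A"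
  obtains Pu Ps l m where "torus_splitting ((*v) (map_matrix of_int A)) Pu Ps l m"
proof -
  obtain l m :: real where lm: "\<bar>l\<bar> > 1" "\<bar>m\<bar> = 1 / \<bar>l\<bar>"
    "l + m = of_int (A $ 1 $ 1 + A $ 2 $ 2)"
    "l * m = of_int (A $ 1 $ 1 * A $ 2 $ 2 - A $ 1 $ 2 * A $ 2 $ 1)"
    using hyperbolic_eigenvalues[OF assms] by blast
  define M :: "real^2^2" where "M = map_matrix of_int A"
  define Pu where "Pu = (\<lambda>x. (1 / (l - m)) *\<^sub>R (M *v x - m *\<^sub>R x))"
  define Ps where "Ps = (\<lambda>x. (1 / (l - m)) *\<^sub>R (l *\<^sub>R x - M *v x))"
  have M: "M $ i $ j = of_int (A $ i $ j)" for i j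
    by (simp add: M_def map_matrix_def)
  have tr: "l + m = M $ 1 $ 1 + M $ 2 $ 2" and dt: "l * m = M $ 1 $ 1 * M $ 2 $ 2 - M $ 1 $ 2 * M $ 2 $ 1"
    using lm(3,4) by (simp_all add: M)
  have "1 / \<bar>l\<bar> < 1" using lm(1) by simp
  then have "\<bar>m\<bar> < \<bar>l\<bar>" using lm(1,2) by linarith
  then have lm0: "l - m \<noteq> 0" by auto
  have CH: "M *v (M *v x) = (l + m) *\<^sub>R (M *v x) - (l * m) *\<^sub>R x" for x
    unfolding tr dt
    by (simp add: vec_eq_iff forall_2 matrix_vector_mult_def sum_2 algebra_simps)
  have "torus_splitting ((*v) M) Pu Ps l m"
  proof (rule torus_splitting.intro)
    show "linear ((*v) M)" by simp
    show "linear Pu" "linear Ps"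
      unfolding Pu_def Ps_def
      by (auto intro!: linear_compose_sub linear_compose_scale_right simp: linear_id[unfolded id_def])
    show "Pu x + Ps x = x" for x
    proof -
      have "Pu x + Ps x = (1 / (l - m)) *\<^sub>R ((l - m) *\<^sub>R x)"
        by (simp add: Pu_def Ps_def algebra_simps flip: scaleR_add_right)
      then show ?thesis using lm0 by simp
    qed
    show "M *v Pu x = l *\<^sub>R Pu x" for x
      by (simp add: Pu_def CH matrix_vector_mult_scaleR matrix_vector_mult_diff_distrib)
        (simp add: algebra_simps)
    show "M *v Ps x = m *\<^sub>R Ps x" for x
      by (simp add: Ps_def CH matrix_vector_mult_scaleR matrix_vector_mult_diff_distrib)
        (simp add: algebra_simps)
    show "\<bar>l\<bar> > 1" "\<bar>m\<bar> = 1 / \<bar>l\<bar>" using lm by auto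
    show "g (\<psi> + M *v axis i (2 * pi)) = g \<psi>" if "torus_fun g" for g \<psi> i
    proof -
      have "\<psi> + M *v axis i (2 * pi)
          = (\<psi> + axis 1 (2 * pi * of_int (A $ 1 $ i))) + axis 2 (2 * pi * of_int (A $ 2 $ i))"
        using exhaust_2[of i] by (auto simp: vec_eq_iff forall_2 matrix_vector_mult_def sum_2 axis_def M)
      then show ?thesis using torus_fun_periodic_int[OF that] by metis
    qed
  qed
  then show ?thesis using that unfolding M_def by blast
qed

section \<open>The slow variable\<close>

text \<open>The mean value inequality for \<open>g z - z * g' x\<close>, whose derivative on the
  segment is at most \<open>L * \<bar>y - x\<bar>\<close>. A Lipschitz bound on the first derivative
  thus stands in for a second derivative, at the price of \<open>L\<close> instead of
  \<open>L / 2\<close>.\<close>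

lemma taylor_remainder_Lipschitz:
  fixes g :: "real \<Rightarrow> real"
  assumes "convex S"
    and deriv: "\<And>z. z \<in> S \<Longrightarrow> (g has_real_derivative g' z) (at z within S)"
    and lip: "\<And>z w. z \<in> S \<Longrightarrow> w \<in> S \<Longrightarrow> \<bar>g' z - g' w\<bar> \<le> L * \<bar>z - w\<bar>"
    and "x \<in> S" "y \<in> S" "0 \<le> L"
  shows "\<bar>g y - g x - (y - x) * g' x\<bar> \<le> L * (y - x)\<^sup>2"
proof -
  let ?S = "closed_segment x y"
  have sub: "?S \<subseteq> S" using assms closed_segment_subset by blast
  have "norm ((g y - y * g' x) - (g x - x * g' x)) \<le> L * \<bar>y - x\<bar> * norm (y - x)"
  proof (rule field_differentiable_bound[of ?S _ "\<lambda>z. g' z - g' x"])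
    show "((\<lambda>z. g z - z * g' x) has_field_derivative g' z - g' x) (at z within ?S)" if "z \<in> ?S" for z
      using DERIV_subset[OF deriv sub] that sub by (auto intro!: derivative_eq_intros)
    show "norm (g' z - g' x) \<le> L * \<bar>y - x\<bar>" if "z \<in> ?S" for z
    proof -
      have "\<bar>z - x\<bar> \<le> \<bar>y - x\<bar>" using that by (auto simp: closed_segment_eq_real_ivl split: if_splits)
      then have "L * \<bar>z - x\<bar> \<le> L * \<bar>y - x\<bar>" using \<open>0 \<le> L\<close> by (rule mult_left_mono)
      then show ?thesis using lip[of z x] that sub \<open>x \<in> S\<close> by fastforce
    qed
  qed auto
  then show ?thesis by (simp add: algebra_simps power2_eq_square abs_mult_self_eq flip: abs_mult)
qed

lemma continuous_on_Lipschitz_Hoelder: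
  fixes g :: "real \<Rightarrow> real^2 \<Rightarrow> real"
  assumes lip: "\<And>x y \<psi>. \<bar>g x \<psi> - g y \<psi>\<bar> \<le> \<bar>x - y\<bar>"
    and hold: "\<And>x \<psi> \<psi>'. \<bar>g x \<psi> - g x \<psi>'\<bar> \<le> K * norm (\<psi> - \<psi>') powr \<alpha>"
    and "0 < \<alpha>"
  shows "continuous_on UNIV (\<lambda>(x, \<psi>). g x \<psi>)"
  unfolding continuous_on_def
proof
  fix z :: "real \<times> (real^2)"
  obtain x \<psi> where z: "z = (x, \<psi>)" by (cases z)
  have "((\<lambda>w. g (fst w) (snd w) - g x \<psi>) \<longlongrightarrow> 0) (at z)"
  proof (rule Lim_null_comparison)
    show "\<forall>\<^sub>F w in at z. norm (g (fst w) (snd w) - g x \<psi>) \<le> \<bar>fst w - x\<bar> + K * norm (snd w - \<psi>) powr \<alpha>"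
      using add_mono[OF lip hold] by (intro always_eventually) (smt (verit) real_norm_def lip hold)
    have "((\<lambda>w. norm (snd w - \<psi>) powr \<alpha>) \<longlongrightarrow> 0) (at z)"
      by (rule tendsto_zero_powrI) (auto intro!: tendsto_eq_intros simp: z \<open>0 < \<alpha>\<close>)
    then have "((\<lambda>w. \<bar>fst w - x\<bar> + K * norm (snd w - \<psi>) powr \<alpha>) \<longlongrightarrow> \<bar>x - x\<bar> + K * 0) (at z)"
      by (intro tendsto_intros) (auto intro!: tendsto_eq_intros simp: z)
    then show "((\<lambda>w. \<bar>fst w - x\<bar> + K * norm (snd w - \<psi>) powr \<alpha>) \<longlongrightarrow> 0) (at z)" by simp
  qed
  then have "((\<lambda>w. g (fst w) (snd w)) \<longlongrightarrow> g x \<psi>) (at z)" by (rule LIM_zero_cancel)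
  then show "((\<lambda>(x, \<psi>). g x \<psi>) \<longlongrightarrow> (case z of (x, \<psi>) \<Rightarrow> g x \<psi>)) (at z within UNIV)"
    by (simp add: z case_prod_unfold)
qed

text \<open>Halving the exponent makes each power occur at most twice, so the bound is twice the
  geometric series.\<close>

lemma sum_power_half_le:
  fixes q :: real
  assumes "0 \<le> q" "q < 1"
  shows "(\<Sum>j<k. q ^ ((k - j) div 2)) \<le> 2 / (1 - q)"
proof -
  have "(\<Sum>i<2 * n. q ^ (i div 2)) = 2 * (\<Sum>i<n. q ^ i)" for n
    by (induction n) (auto simp: algebra_simps)
  moreover have "(\<Sum>i<n. q ^ i) \<le> 1 / (1 - q)" for n
    using assms by (simp add: sum_gp_strict divide_right_mono)
  ultimately have le: "(\<Sum>i<2 * n. q ^ (i div 2)) \<le> 2 / (1 - q)" for n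
    by (metis mult_left_mono times_divide_eq_right mult.right_neutral zero_le_numeral)
  have "(\<Sum>j<k. q ^ ((k - j) div 2)) = (\<Sum>j<k. q ^ (Suc (k - Suc j) div 2))"
    by (intro sum.cong) (auto simp: Suc_diff_Suc)
  also have "\<dots> = (\<Sum>i<k. q ^ (Suc i div 2))"
    by (rule sum.nat_diff_reindex)
  also have "\<dots> \<le> (\<Sum>i<k. q ^ (i div 2))"
    using assms by (intro sum_mono power_decreasing) auto
  also have "\<dots> \<le> (\<Sum>i<2 * k. q ^ (i div 2))"
    using assms by (intro sum_mono2) auto
  finally show ?thesis using le by (rule order_trans)
qed

text \<open>The constants 1 come from the normalisation of \<open>f\<close>; the Lipschitz bound on
  \<open>f1\<close> reflects the bounded second slow derivative. Attraction is recorded only at 0,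
  the zero of the averaged field, and is extended to a neighbourhood by that Lipschitz
  bound.\<close>

locale fast_slow = torus_splitting +
  fixes f f1 :: "real \<Rightarrow> real^2 \<Rightarrow> real" and \<alpha> K a b \<gamma> :: real
  assumes f_deriv: "((\<lambda>x. f x \<psi>) has_real_derivative f1 x \<psi>) (at x)"
    and f_bound: "\<bar>f x \<psi>\<bar> \<le> 1"
    and f1_bound: "\<bar>f1 x \<psi>\<bar> \<le> 1"
    and f1_Lipschitz: "\<bar>f1 x \<psi> - f1 y \<psi>\<bar> \<le> \<bar>x - y\<bar>"
    and f_Hoelder: "\<bar>f x \<psi> - f x \<psi>'\<bar> \<le> K * norm (\<psi> - \<psi>') powr \<alpha>"
    and f1_Hoelder: "\<bar>f1 x \<psi> - f1 x \<psi>'\<bar> \<le> K * norm (\<psi> - \<psi>') powr \<alpha>"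
    and f_periodic: "f x (\<psi> + axis i (2 * pi)) = f x \<psi>"
    and \<alpha>_pos: "0 < \<alpha>" and K_nonneg: "0 \<le> K"
    and a_less_b: "a < b" and f_left: "f a \<psi> > 0" and f_right: "f b \<psi> < 0"
    and avg_zero: "x \<in> {a..b} \<Longrightarrow> torus_avg (f x) = 0 \<longleftrightarrow> x = 0"
    and \<gamma>_pos: "0 < \<gamma>" and f1_zero: "f1 0 \<psi> \<le> - \<gamma>"
begin

section \<open>The averaged field and its derivative\<close>

definition u :: "real \<Rightarrow> real" where "u x = torus_avg (f x)"

definition p :: "real \<Rightarrow> real" where "p x = torus_avg (f1 x)"

lemma f_Lipschitz: "\<bar>f x \<psi> - f y \<psi>\<bar> \<le> \<bar>x - y\<bar>"
  using field_differentiable_bound[of UNIV "\<lambda>x. f x \<psi>" "\<lambda>x. f1 x \<psi>" 1 x y] f_deriv f1_bound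
  by auto

text \<open>One step moves the slow variable by at most \<rho>, so this gives the increment of
  \<open>f\<close> over a step a Hoelder constant of order \<rho>.\<close>

lemma f_mixed:
  "\<bar>(f x \<psi> - f x \<psi>') - (f y \<psi> - f y \<psi>')\<bar> \<le> K * norm (\<psi> - \<psi>') powr \<alpha> * \<bar>x - y\<bar>"
  using field_differentiable_bound[of UNIV "\<lambda>x. f x \<psi> - f x \<psi>'" "\<lambda>x. f1 x \<psi> - f1 x \<psi>'"
      "K * norm (\<psi> - \<psi>') powr \<alpha>" x y] DERIV_diff[OF f_deriv f_deriv] f1_Hoelder
  by auto

lemma continuous_f: "continuous_on UNIV (\<lambda>(x, \<psi>). f x \<psi>)"
  by (rule continuous_on_Lipschitz_Hoelder[OF f_Lipschitz f_Hoelder \<alpha>_pos])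

lemma continuous_f1: "continuous_on UNIV (\<lambda>(x, \<psi>). f1 x \<psi>)"
  by (rule continuous_on_Lipschitz_Hoelder[OF f1_Lipschitz f1_Hoelder \<alpha>_pos])

lemma continuous_f_right: "continuous_on UNIV (f x)"
  by (rule continuous_on_uncurry[OF continuous_f]) (auto intro: continuous_intros)

lemma continuous_f1_right: "continuous_on UNIV (f1 x)"
  by (rule continuous_on_uncurry[OF continuous_f1]) (auto intro: continuous_intros)

lemma torus_fun_f: "torus_fun (f x)"
  by (simp add: torus_fun_def continuous_f_right f_periodic)

lemma u_bound: "\<bar>u x\<bar> \<le> 1"
  unfolding u_def by (intro torus_avg_abs_le continuous_f_right f_bound)

lemma p_bound: "\<bar>p x\<bar> \<le> 1"
  unfolding p_def by (intro torus_avg_abs_le continuous_f1_right f1_bound)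

lemma u_Lipschitz: "\<bar>u x - u y\<bar> \<le> \<bar>x - y\<bar>"
  unfolding u_def by (intro torus_avg_abs_diff_le continuous_f_right f_Lipschitz)

lemma p_Lipschitz: "\<bar>p x - p y\<bar> \<le> \<bar>x - y\<bar>"
  unfolding p_def by (intro torus_avg_abs_diff_le continuous_f1_right f1_Lipschitz)

lemma p_zero: "p 0 \<le> - \<gamma>"
proof -
  have "torus_avg (f1 0) \<le> torus_avg (\<lambda>_. - \<gamma>)"
    by (intro torus_avg_mono continuous_f1_right f1_zero) simp
  then show ?thesis by (simp add: p_def)
qed

text \<open>Averaging the pointwise Taylor estimate, whose remainder is uniform in the fast
  variable, replaces differentiation under the integral; it identifies \<open>p\<close> as the
  derivative of \<open>u\<close>.\<close>

lemma u_taylor: "\<bar>u y - u x - (y - x) * p x\<bar> \<le> (y - x)\<^sup>2"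
proof -
  have "\<bar>f y \<psi> - (f x \<psi> + (y - x) * f1 x \<psi>)\<bar> \<le> (y - x)\<^sup>2" for \<psi>
    using taylor_remainder_Lipschitz[of UNIV "\<lambda>x. f x \<psi>" "\<lambda>x. f1 x \<psi>" 1 x y]
      f_deriv f1_Lipschitz by (simp add: algebra_simps)
  then have "\<bar>torus_avg (f y) - torus_avg (\<lambda>\<psi>. f x \<psi> + (y - x) * f1 x \<psi>)\<bar> \<le> (y - x)\<^sup>2"
    by (intro torus_avg_abs_diff_le continuous_f_right continuous_f1_right continuous_intros)
  also have "torus_avg (\<lambda>\<psi>. f x \<psi> + (y - x) * f1 x \<psi>) = u x + (y - x) * p x"
    by (simp add: torus_avg_add torus_avg_cmult u_def p_def continuous_f_right continuous_f1_right
        continuous_on_mult)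
  finally show ?thesis by (simp add: u_def algebra_simps)
qed

lemma u_deriv: "(u has_real_derivative p x) (at x)"
  unfolding has_field_derivative_iff
proof (rule LIM_zero_cancel, rule Lim_null_comparison)
  show "\<forall>\<^sub>F y in at x. norm ((u y - u x) / (y - x) - p x) \<le> \<bar>y - x\<bar>"
    unfolding eventually_at_filter
  proof (intro always_eventually allI impI)
    fix y assume "y \<noteq> x"
    then have "(u y - u x) / (y - x) - p x = (u y - u x - (y - x) * p x) / (y - x)"
      by (simp add: field_simps)
    also have "norm \<dots> \<le> (y - x)\<^sup>2 / \<bar>y - x\<bar>"
      using u_taylor by (simp add: divide_right_mono)
    also have "\<dots> = \<bar>y - x\<bar>"
      using \<open>y \<noteq> x\<close> by (simp add: field_simps power2_eq_square flip: abs_mult)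
    finally show "norm ((u y - u x) / (y - x) - p x) \<le> \<bar>y - x\<bar>" .
  qed
  show "((\<lambda>y. \<bar>y - x\<bar>) \<longlongrightarrow> 0) (at x)"
    by (auto intro!: tendsto_eq_intros)
qed

lemma continuous_on_u: "continuous_on S u"
  using u_deriv by (meson DERIV_isCont continuous_at_imp_continuous_on)

lemma u_left: "u a > 0"
  unfolding u_def by (intro torus_avg_pos continuous_f_right f_left)

lemma u_right: "u b < 0"
proof -
  have "torus_avg (\<lambda>\<psi>. (- 1) * f b \<psi>) > 0"
    by (intro torus_avg_pos continuous_intros continuous_f_right) (simp add: f_right)
  then show ?thesis by (simp only: torus_avg_cmult u_def)
qed

lemma zero_between: "a < 0" "0 < b"
proof -
  obtain z where z: "a \<le> z" "z \<le> b" "u z = 0"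
    using IVT2'[of u b 0 a] continuous_on_u[of "{a..b}"] u_left u_right a_less_b by auto
  then have "z = 0" using avg_zero[of z] by (simp add: u_def)
  then show "a < 0" "0 < b" using z u_left u_right by (metis less_irrefl order_le_less)+
qed

lemma u_pos:
  assumes "a \<le> x" "x < 0"
  shows "u x > 0"
proof (rule ccontr)
  assume "\<not> u x > 0"
  then obtain z where z: "a \<le> z" "z \<le> x" "u z = 0"
    using IVT2'[of u x 0 a] continuous_on_u[of "{a..x}"] u_left assms by auto
  then show False using avg_zero[of z] assms zero_between by (auto simp: u_def)
qed

lemma u_neg:
  assumes "0 < x" "x \<le> b"
  shows "u x < 0"
proof (rule ccontr)
  assume "\<not> u x < 0"
  then obtain z where z: "x \<le> z" "z \<le> b" "u z = 0"
    using IVT2'[of u b 0 x] continuous_on_u[of "{x..b}"] u_right assms by auto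
  then show False using avg_zero[of z] assms zero_between by (auto simp: u_def)
qed

lemma u_zero: "u 0 = 0"
  using avg_zero[of 0] zero_between by (simp add: u_def)

text \<open>As \<open>f\<close> has Lipschitz constant 1 in the slow variable and points inwards at
  both ends, its value at \<open>z\<close> lies above \<open>- (z - a)\<close> and below
  \<open>b - z\<close>. Scaling by \<rho> \<le> 1 cannot overshoot.\<close>

lemma slow_step_mem:
  assumes "z \<in> {a..b}" "0 \<le> \<rho>" "\<rho> \<le> 1"
  shows "z + \<rho> * f z \<psi> \<in> {a..b}"
proof -
  have "f z \<psi> \<ge> - (z - a)" "f z \<psi> \<le> b - z"
    using f_Lipschitz[of z \<psi> a] f_Lipschitz[of z \<psi> b] f_left[of \<psi>] f_right[of \<psi>] assms(1) by auto
  then have "\<rho> * f z \<psi> \<ge> \<rho> * - (z - a)" "\<rho> * f z \<psi> \<le> \<rho> * (b - z)"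
    using assms(2) by (auto intro: mult_left_mono)
  moreover have "\<rho> * (z - a) \<le> z - a" "\<rho> * (b - z) \<le> b - z"
    using assms by (auto intro: mult_left_le_one_le)
  ultimately show ?thesis by (auto simp: right_diff_distrib)
qed

section \<open>Slow orbits and their correlations with the fast dynamics\<close>

primrec slow :: "real \<Rightarrow> real \<Rightarrow> nat \<Rightarrow> real^2 \<Rightarrow> real" where
  "slow \<rho> x 0 \<psi> = x"
| "slow \<rho> x (Suc n) \<psi> = slow \<rho> x n \<psi> + \<rho> * f (slow \<rho> x n \<psi>) ((T ^^ n) \<psi>)"

lemma slow_mem:
  assumes "x \<in> {a..b}" "0 \<le> \<rho>" "\<rho> \<le> 1"
  shows "slow \<rho> x n \<psi> \<in> {a..b}"
  by (induction n) (use assms slow_step_mem in auto)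

lemma torus_fun_slow: "torus_fun (slow \<rho> x n)"
proof (induction n)
  case 0
  show ?case by (simp add: torus_fun_def)
next
  case (Suc n)
  have "continuous_on UNIV (\<lambda>\<psi>. slow \<rho> x n \<psi> + \<rho> * f (slow \<rho> x n \<psi>) ((T ^^ n) \<psi>))"
    by (intro continuous_intros continuous_on_uncurry[OF continuous_f] continuous_on_T_pow
        torus_fun_continuous[OF Suc])
  then show ?case
    using torus_fun_periodic[OF Suc] torus_fun_periodic[OF torus_fun_T_pow[OF torus_fun_f]]
    by (simp add: torus_fun_def)
qed

lemma slow_increment: "\<bar>slow \<rho> x (Suc n) \<psi> - slow \<rho> x n \<psi>\<bar> \<le> \<rho>" if "0 \<le> \<rho>"
  using mult_left_mono[OF f_bound that] that by (simp add: abs_mult)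

definition \<theta> :: real where "\<theta> = \<bar>l\<bar> powr \<alpha>"

definition unst_const :: real where "unst_const = 2 * K / (\<theta> - 1)"

lemma \<theta>_gt: "\<theta> > 1"
  unfolding \<theta>_def using expanding \<alpha>_pos by simp

lemma unst_const_nonneg: "0 \<le> unst_const"
  using \<theta>_gt K_nonneg by (simp add: unst_const_def)

lemma unst_powr_Suc: "(\<bar>l\<bar> ^ Suc n * r) powr \<alpha> = \<theta> * (\<bar>l\<bar> ^ n * r) powr \<alpha>" if "0 \<le> r"
  using that by (simp add: \<theta>_def powr_mult mult.assoc)

text \<open>The constant is proportional to \<open>\<rho>\<close> and uniform in \<open>n\<close>, because the expansion \<open>\<theta>\<close> of the
  unstable distances dominates the possible growth \<open>1 + \<rho>\<close> of the slow differences.\<close>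

lemma slow_unstable:
  assumes "0 \<le> \<rho>" "\<rho> \<le> (\<theta> - 1) / 2"
  shows "\<bar>slow \<rho> x n (\<psi> + Pu z) - slow \<rho> x n \<psi>\<bar>
    \<le> \<rho> * unst_const * (\<bar>l\<bar> ^ n * norm (Pu z)) powr \<alpha>"
proof (induction n)
  case 0
  show ?case using assms unst_const_nonneg by simp
next
  case (Suc n)
  define A B where "A = slow \<rho> x n (\<psi> + Pu z)" and "B = slow \<rho> x n \<psi>"
  define y where "y = (T ^^ n) \<psi>"
  define r where "r = (\<bar>l\<bar> ^ n * norm (Pu z)) powr \<alpha>"
  have y': "(T ^^ n) (\<psi> + Pu z) = y + l ^ n *\<^sub>R Pu z"
    by (simp add: y_def linear_add[OF linear_T_pow] T_pow_Pu)
  have IH: "\<bar>A - B\<bar> \<le> \<rho> * unst_const * r"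
    using Suc by (simp add: A_def B_def r_def)
  have "\<bar>f A (y + l ^ n *\<^sub>R Pu z) - f B y\<bar>
      \<le> \<bar>f A (y + l ^ n *\<^sub>R Pu z) - f A y\<bar> + \<bar>f A y - f B y\<bar>"
    by linarith
  also have "\<dots> \<le> K * r + \<bar>A - B\<bar>"
    using f_Hoelder[of A "y + l ^ n *\<^sub>R Pu z" y] f_Lipschitz[of A y B] by (simp add: r_def power_abs)
  finally have "\<rho> * \<bar>f A (y + l ^ n *\<^sub>R Pu z) - f B y\<bar> \<le> \<rho> * (K * r + \<bar>A - B\<bar>)"
    using assms(1) by (rule mult_left_mono)
  then have "\<bar>\<rho> * f A (y + l ^ n *\<^sub>R Pu z) - \<rho> * f B y\<bar> \<le> \<rho> * K * r + \<rho> * \<bar>A - B\<bar>"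
    using assms(1) by (simp add: abs_mult distrib_left mult.assoc flip: right_diff_distrib)
  then have "\<bar>slow \<rho> x (Suc n) (\<psi> + Pu z) - slow \<rho> x (Suc n) \<psi>\<bar> \<le> (1 + \<rho>) * \<bar>A - B\<bar> + \<rho> * K * r"
    by (simp add: y' distrib_right flip: A_def B_def y_def)
  also have "\<dots> \<le> (1 + \<rho>) * (\<rho> * unst_const * r) + \<rho> * K * r"
    using IH assms(1) by (intro add_right_mono mult_left_mono) auto
  also have "\<dots> = \<rho> * r * ((1 + \<rho>) * unst_const + K)"
    by (simp add: algebra_simps)
  also have "\<dots> \<le> \<rho> * r * (\<theta> * unst_const)"
  proof (rule mult_left_mono)
    have "K = (\<theta> - 1) / 2 * unst_const" using \<theta>_gt by (simp add: unst_const_def)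
    moreover have "\<rho> * unst_const \<le> (\<theta> - 1) / 2 * unst_const"
      using assms(2) unst_const_nonneg by (rule mult_right_mono)
    ultimately show "(1 + \<rho>) * unst_const + K \<le> \<theta> * unst_const"
      by (simp add: field_simps)
  qed (use assms(1) in \<open>simp add: r_def\<close>)
  also have "\<dots> = \<rho> * unst_const * (\<bar>l\<bar> ^ Suc n * norm (Pu z)) powr \<alpha>"
    by (simp only: unst_powr_Suc[OF norm_ge_zero] r_def) (simp add: mult_ac)
  finally show ?case .
qed

text \<open>The factors are the 2 of \<open>decorrelation\<close>, the Hoelder constant
  \<open>K'\<close> of one backward step divided by \<open>M * \<rho>\<close>, the size of the
  fundamental square, and the sum over all steps with ratio \<open>1 / \<theta>\<close>. In the
  second factor \<open>\<theta> + 1\<close> accounts for the slow positions at the two times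
  \<open>Suc j\<close> and \<open>j\<close>.\<close>

definition corr_const :: real where
  "corr_const = 2 * (2 * K + 4 * unst_const * (\<theta> + 1)) * split_const powr \<alpha> * (2 / (1 - 1 / \<theta>))"

lemma corr_const_nonneg: "0 \<le> corr_const"
  using \<theta>_gt unst_const_nonneg K_nonneg by (auto simp: corr_const_def intro!: mult_nonneg_nonneg)

lemma slow_correlation:
  assumes \<rho>: "0 \<le> \<rho>" "\<rho> \<le> 1" "\<rho> \<le> (\<theta> - 1) / 2" and x: "x \<in> {a..b}"
    and w_bound: "\<And>z. z \<in> {a..b} \<Longrightarrow> \<bar>w z\<bar> \<le> M"
    and w_Lipschitz: "\<And>z z'. z \<in> {a..b} \<Longrightarrow> z' \<in> {a..b} \<Longrightarrow> \<bar>w z - w z'\<bar> \<le> M * \<bar>z - z'\<bar>"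
  shows "\<bar>torus_avg (\<lambda>\<psi>. w (slow \<rho> x k \<psi>) * (f (slow \<rho> x k \<psi>) ((T ^^ k) \<psi>) - u (slow \<rho> x k \<psi>)))\<bar>
    \<le> corr_const * M * \<rho>"
proof -
  define X where "X = slow \<rho> x"
  \<comment> \<open>Subtracting \<open>u\<close> centres the observable: with the slow argument
    frozen, its mean over the torus is zero.\<close>
  define H where "H = (\<lambda>z \<psi>. w z * (f z \<psi> - u z))"
  define D where "D = (\<lambda>j \<psi> \<psi>'. H (X (Suc j) \<psi>) \<psi>' - H (X j \<psi>) \<psi>')"
  define K' where "K' = M * \<rho> * (2 * K + 4 * unst_const * (\<theta> + 1))"
  have M: "0 \<le> M" using w_bound[OF x] by linarith
  have K': "0 \<le> K'" using M \<rho>(1) \<theta>_gt unst_const_nonneg K_nonneg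
    by (auto simp: K'_def intro!: mult_nonneg_nonneg)
  have Xmem: "X j \<psi> \<in> {a..b}" for j \<psi>
    unfolding X_def by (rule slow_mem[OF x \<rho>(1,2)])
  have Xper: "X j (\<psi> + axis i (2 * pi)) = X j \<psi>" for j \<psi> i
    unfolding X_def by (rule torus_fun_periodic[OF torus_fun_slow])
  have Xcont: "continuous_on S (X j)" for j S
    unfolding X_def using torus_fun_continuous[OF torus_fun_slow] continuous_on_subset by blast
  have "M-lipschitz_on {a..b} w"
    using w_Lipschitz M by (auto simp: lipschitz_on_def dist_real_def)
  then have wcont: "continuous_on {a..b} w"
    by (rule lipschitz_on_continuous_on)
  have XcontS: "continuous_on S (\<lambda>s. X j (h s))" if "continuous_on S h" for j h and S :: "((real^2) \<times> (real^2)) set"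
    by (rule continuous_on_compose2[OF Xcont that]) auto
  have XcontS': "continuous_on S (\<lambda>s. X j (h s))" if "continuous_on S h" for j h and S :: "(real^2) set"
    by (rule continuous_on_compose2[OF Xcont that]) auto
  have Hcont: "continuous_on UNIV (\<lambda>(\<psi>, \<psi>'). H (X j \<psi>) \<psi>')" for j
    unfolding H_def case_prod_unfold
    by (intro continuous_intros continuous_on_uncurry[OF continuous_f]
        continuous_on_compose2[OF wcont] continuous_on_compose2[OF continuous_on_u[of UNIV]] XcontS)
      (use Xmem in auto)
  have Hzero: "torus_avg (H z) = 0" for z
    by (simp add: H_def torus_avg_cmult torus_avg_diff continuous_f_right u_def)
  have Hfun: "torus_fun (H z)" for z
    unfolding torus_fun_def H_def
    by (auto intro!: continuous_intros continuous_f_right simp: f_periodic)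
  have cont: "continuous_on UNIV (\<lambda>(\<psi>, \<psi>'). D j \<psi> \<psi>')" for j
    unfolding D_def using continuous_on_diff[OF Hcont Hcont] by (simp add: case_prod_unfold)
  have cont_k: "continuous_on UNIV (\<lambda>\<psi>. H (X j \<psi>) ((T ^^ k) \<psi>))" for j
    by (intro continuous_on_uncurry[OF Hcont] continuous_on_T_pow continuous_intros)
  \<comment> \<open>The constant 4 is 2 for varying \<open>w\<close> against
    \<open>\<bar>f - u\<bar> \<le> 2\<close>, plus 2 for varying \<open>f\<close> and
    \<open>u\<close>, each with Lipschitz constant 1.\<close>
  have H_Lip: "\<bar>H z y - H z' y\<bar> \<le> 4 * M * \<bar>z - z'\<bar>" if "z \<in> {a..b}" "z' \<in> {a..b}" for z z' y
  proof -
    have "\<bar>(w z - w z') * (f z y - u z)\<bar> \<le> (M * \<bar>z - z'\<bar>) * 2"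
      unfolding abs_mult using w_Lipschitz[OF that] f_bound[of z y] u_bound[of z]
      by (intro mult_mono) (auto simp: M)
    moreover have "\<bar>w z' * ((f z y - f z' y) - (u z - u z'))\<bar> \<le> M * (2 * \<bar>z - z'\<bar>)"
    proof -
      have "\<bar>(f z y - f z' y) - (u z - u z')\<bar> \<le> 2 * \<bar>z - z'\<bar>"
        using abs_triangle_ineq4 add_mono[OF f_Lipschitz[of z y z'] u_Lipschitz[of z z']]
        unfolding mult_2 by (rule order_trans)
      then show ?thesis
        unfolding abs_mult using w_bound[OF that(2)] by (intro mult_mono) (auto simp: M)
    qed
    moreover have "H z y - H z' y = (w z - w z') * (f z y - u z) + w z' * ((f z y - f z' y) - (u z - u z'))"
      by (simp add: H_def algebra_simps)
    ultimately show ?thesis by linarith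
  qed
  have bound: "\<bar>torus_avg (\<lambda>\<psi>. D j \<psi> ((T ^^ k) \<psi>))\<bar>
      \<le> 2 * K' * (split_const * (1 / \<bar>l\<bar>) ^ ((k - j) div 2)) powr \<alpha>" if "j < k" for j
  proof (rule decorrelation[OF cont])
    show "torus_fun (D j \<psi>)" for \<psi>
      unfolding torus_fun_def D_def
      using torus_fun_continuous[OF Hfun] torus_fun_periodic[OF Hfun] by (auto intro: continuous_on_diff)
    show "torus_fun (\<lambda>\<psi>. D j \<psi> \<psi>')" for \<psi>'
    proof -
      have "continuous_on UNIV (\<lambda>\<psi>. D j \<psi> \<psi>')"
        by (rule continuous_on_uncurry[OF cont]) (auto intro: continuous_intros)
      then show ?thesis by (simp add: torus_fun_def) (simp add: D_def Xper)
    qed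
    show "torus_avg (D j \<psi>) = 0" for \<psi>
      using torus_fun_continuous[OF Hfun] by (simp add: D_def torus_avg_diff Hzero)
    show "\<bar>D j (\<psi> + Pu z) \<psi>' - D j \<psi> \<psi>'\<bar> \<le> K' * (\<bar>l\<bar> ^ j * norm (Pu z)) powr \<alpha>" for \<psi> \<psi>' z
    proof -
      define r where "r = (\<bar>l\<bar> ^ j * norm (Pu z)) powr \<alpha>"
      have "\<bar>X j (\<psi> + Pu z) - X j \<psi>\<bar> \<le> \<rho> * unst_const * r"
        unfolding X_def r_def by (rule slow_unstable[OF \<rho>(1,3)])
      moreover have "\<bar>X (Suc j) (\<psi> + Pu z) - X (Suc j) \<psi>\<bar> \<le> \<rho> * unst_const * (\<theta> * r)"
        unfolding X_def r_def unst_powr_Suc[OF norm_ge_zero, symmetric] by (rule slow_unstable[OF \<rho>(1,3)])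
      ultimately have "\<bar>X (Suc j) (\<psi> + Pu z) - X (Suc j) \<psi>\<bar> + \<bar>X j (\<psi> + Pu z) - X j \<psi>\<bar>
          \<le> \<rho> * unst_const * (\<theta> + 1) * r"
        by (simp add: algebra_simps)
      then have "4 * M * (\<bar>X (Suc j) (\<psi> + Pu z) - X (Suc j) \<psi>\<bar> + \<bar>X j (\<psi> + Pu z) - X j \<psi>\<bar>)
          \<le> 4 * M * (\<rho> * unst_const * (\<theta> + 1) * r)"
        using M by (intro mult_left_mono) auto
      then have "\<bar>D j (\<psi> + Pu z) \<psi>' - D j \<psi> \<psi>'\<bar> \<le> 4 * M * (\<rho> * unst_const * (\<theta> + 1) * r)"
        using H_Lip[OF Xmem Xmem, of "Suc j" "\<psi> + Pu z" \<psi>' "Suc j" \<psi>] H_Lip[OF Xmem Xmem, of j "\<psi> + Pu z" \<psi>' j \<psi>]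
        unfolding D_def distrib_left by linarith
      also have "\<dots> \<le> K' * r"
        using M \<rho>(1) K_nonneg by (simp add: K'_def algebra_simps r_def)
      finally show ?thesis by (simp add: r_def)
    qed
    show "\<bar>D j \<psi> \<psi>' - D j \<psi> \<psi>''\<bar> \<le> K' * norm (\<psi>' - \<psi>'') powr \<alpha>" for \<psi> \<psi>' \<psi>''
    proof -
      define z z' where "z = X j \<psi>" and "z' = X (Suc j) \<psi>"
      define r where "r = norm (\<psi>' - \<psi>'') powr \<alpha>"
      have r: "0 \<le> r" by (simp add: r_def)
      have zz: "\<bar>z' - z\<bar> \<le> \<rho>"
        unfolding z_def z'_def X_def by (rule slow_increment[OF \<rho>(1)])
      have mem: "z \<in> {a..b}" "z' \<in> {a..b}" using Xmem by (simp_all add: z_def z'_def)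
      have "M * \<bar>z' - z\<bar> \<le> M * \<rho>" using zz M by (rule mult_left_mono)
      then have "\<bar>w z' - w z\<bar> \<le> M * \<rho>" using w_Lipschitz[OF mem(2,1)] by linarith
      then have 1: "\<bar>(w z' - w z) * (f z' \<psi>' - f z' \<psi>'')\<bar> \<le> (M * \<rho>) * (K * r)"
        unfolding abs_mult r_def using f_Hoelder M \<rho>(1) by (intro mult_mono) auto
      have "K * r * \<bar>z' - z\<bar> \<le> K * r * \<rho>" using zz K_nonneg r by (intro mult_left_mono) auto
      then have "\<bar>(f z' \<psi>' - f z' \<psi>'') - (f z \<psi>' - f z \<psi>'')\<bar> \<le> K * r * \<rho>"
        using f_mixed[of z' \<psi>' \<psi>'' z] unfolding r_def by linarith
      then have 2: "\<bar>w z * ((f z' \<psi>' - f z' \<psi>'') - (f z \<psi>' - f z \<psi>''))\<bar> \<le> M * (K * r * \<rho>)"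
        unfolding abs_mult using w_bound[OF mem(1)] M by (intro mult_mono) auto
      \<comment> \<open>The averaged field cancels because both fast arguments are taken at the same
        slow position. Each remaining term carries a \<rho>: \<open>w\<close> changes by at most
        \<open>M * \<rho>\<close> in one step, and \<open>f_mixed\<close> handles the change of
        \<open>f\<close>.\<close>
      have "D j \<psi> \<psi>' - D j \<psi> \<psi>'' = (w z' - w z) * (f z' \<psi>' - f z' \<psi>'')
          + w z * ((f z' \<psi>' - f z' \<psi>'') - (f z \<psi>' - f z \<psi>''))"
        by (simp add: D_def H_def z_def z'_def algebra_simps)
      then have "\<bar>D j \<psi> \<psi>' - D j \<psi> \<psi>''\<bar> \<le> M * \<rho> * (2 * K) * r"
        using 1 2 by (simp add: algebra_simps)
      also have "\<dots> \<le> K' * r"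
        unfolding K'_def using M \<rho>(1) r \<theta>_gt unst_const_nonneg
        by (intro mult_right_mono mult_left_mono) auto
      finally show ?thesis by (simp add: r_def)
    qed
  qed (use that K' \<alpha>_pos in auto)
  have q: "0 \<le> 1 / \<theta>" "1 / \<theta> < 1" using \<theta>_gt by auto
  have pw: "(split_const * (1 / \<bar>l\<bar>) ^ i) powr \<alpha> = split_const powr \<alpha> * (1 / \<theta>) ^ i" for i
  proof -
    have "((1 / \<bar>l\<bar>) ^ i) powr \<alpha> = ((1 / \<bar>l\<bar>) powr \<alpha>) ^ i"
      using expanding by (simp add: powr_powr powr_realpow[symmetric] mult.commute)
    then show ?thesis using split_const_nonneg by (simp add: powr_mult powr_divide \<theta>_def)
  qed
  have "torus_avg (\<lambda>\<psi>. H (X k \<psi>) ((T ^^ k) \<psi>)) - torus_avg (\<lambda>\<psi>. H (X 0 \<psi>) ((T ^^ k) \<psi>))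
      = (\<Sum>j<k. torus_avg (\<lambda>\<psi>. H (X (Suc j) \<psi>) ((T ^^ k) \<psi>)) - torus_avg (\<lambda>\<psi>. H (X j \<psi>) ((T ^^ k) \<psi>)))"
    by (rule sum_lessThan_telescope[symmetric])
  also have "\<dots> = (\<Sum>j<k. torus_avg (\<lambda>\<psi>. D j \<psi> ((T ^^ k) \<psi>)))"
    unfolding D_def by (simp only: torus_avg_diff[OF cont_k cont_k])
  \<comment> \<open>At time 0 the slow variable is the constant \<open>x\<close>, so invariance of
    the average under \<open>T\<close> leaves the mean of \<open>H x\<close>.\<close>
  also have "torus_avg (\<lambda>\<psi>. H (X 0 \<psi>) ((T ^^ k) \<psi>)) = 0"
    using torus_avg_T_pow[OF Hfun] by (simp add: X_def Hzero)
  finally have "\<bar>torus_avg (\<lambda>\<psi>. H (X k \<psi>) ((T ^^ k) \<psi>))\<bar> \<le> (\<Sum>j<k. \<bar>torus_avg (\<lambda>\<psi>. D j \<psi> ((T ^^ k) \<psi>))\<bar>)"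
    by simp
  also have "\<dots> \<le> (\<Sum>j<k. 2 * K' * (split_const powr \<alpha> * (1 / \<theta>) ^ ((k - j) div 2)))"
    using bound by (intro sum_mono) (simp add: pw)
  also have "\<dots> = 2 * K' * split_const powr \<alpha> * (\<Sum>j<k. (1 / \<theta>) ^ ((k - j) div 2))"
    by (simp add: sum_distrib_left mult.assoc)
  also have "\<dots> \<le> 2 * K' * split_const powr \<alpha> * (2 / (1 - 1 / \<theta>))"
    using K' by (intro mult_left_mono sum_power_half_le q) auto
  also have "\<dots> = corr_const * M * \<rho>"
    by (simp add: corr_const_def K'_def)
  finally show ?thesis by (simp add: H_def X_def)
qed

end

section \<open>Contraction of the averaged Euler map\<close>

text \<open>This is \<open>ln r \<le> r - 1\<close> for the quotient \<open>r\<close> of the smaller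
  by the larger number. The factor \<open>M\<close> later carries the decay of a product over to
  differences of such products.\<close>

lemma abs_diff_le_ln_diff:
  fixes s t :: real
  assumes "0 < s" "0 < t" "s \<le> M" "t \<le> M"
  shows "\<bar>s - t\<bar> \<le> M * \<bar>ln s - ln t\<bar>"
proof -
  have *: "y - x \<le> M * (ln y - ln x)" if "0 < x" "x \<le> y" "y \<le> M" for x y :: real
  proof -
    have "ln (x / y) \<le> x / y - 1" using that by (intro ln_le_minus_one) auto
    then have "1 - x / y \<le> ln y - ln x" using that by (simp add: ln_div)
    then have "y * (1 - x / y) \<le> y * (ln y - ln x)" using that by (intro mult_left_mono) auto
    also have "\<dots> \<le> M * (ln y - ln x)" using that by (intro mult_right_mono) auto
    also have "y * (1 - x / y) = y - x" using that by (simp add: field_simps)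
    finally show ?thesis .
  qed
  show ?thesis
  proof (cases "s \<le> t")
    case True
    then show ?thesis using *[of s t] assms by simp
  next
    case False
    then show ?thesis using *[of t s] assms by simp
  qed
qed

text \<open>From \<open>exp (c * \<rho>) \<ge> 1 + c * \<rho>\<close>, one minus the ratio is at
  least \<open>c * \<rho> / (1 + c)\<close>, which absorbs the factor \<rho>. This bound is what
  makes one-step errors of order \<rho>^2 add up to order \<rho> for every number of steps.\<close>

lemma sum_exp_le:
  fixes c \<rho> :: real
  assumes "0 < c" "0 < \<rho>" "\<rho> \<le> 1"
  shows "(\<Sum>i<n. \<rho> * exp (- c * \<rho>) ^ i) \<le> (1 + c) / c"
proof -
  define \<kappa> where "\<kappa> = exp (- c * \<rho>)"
  have "\<kappa> < 1" "0 \<le> \<kappa>" using mult_pos_pos[OF assms(1,2)] by (simp_all add: \<kappa>_def)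
  have "1 + c * \<rho> \<le> exp (c * \<rho>)" by (rule exp_ge_add_one_self)
  then have "\<kappa> * (1 + c * \<rho>) \<le> \<kappa> * exp (c * \<rho>)" using \<open>0 \<le> \<kappa>\<close> by (rule mult_left_mono)
  also have "\<dots> = 1" by (simp add: \<kappa>_def flip: exp_add)
  finally have "\<kappa> * (1 + c * \<rho>) \<le> 1" .
  then have "c * \<rho> \<le> (1 - \<kappa>) * (1 + c * \<rho>)" by (simp add: algebra_simps)
  also have "\<dots> \<le> (1 - \<kappa>) * (1 + c)"
    using \<open>\<kappa> < 1\<close> assms by (intro mult_left_mono) auto
  finally have "\<rho> / (1 - \<kappa>) \<le> (1 + c) / c"
    using assms \<open>\<kappa> < 1\<close> by (simp add: field_simps)
  moreover have "(\<Sum>i<n. \<rho> * \<kappa> ^ i) \<le> \<rho> / (1 - \<kappa>)"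
  proof -
    have "(\<Sum>i<n. \<kappa> ^ i) = (1 - \<kappa> ^ n) / (1 - \<kappa>)" using \<open>\<kappa> < 1\<close> by (simp add: sum_gp_strict)
    also have "\<dots> \<le> 1 / (1 - \<kappa>)" using \<open>\<kappa> < 1\<close> \<open>0 \<le> \<kappa>\<close> by (intro divide_right_mono) auto
    finally have "\<rho> * (\<Sum>i<n. \<kappa> ^ i) \<le> \<rho> * (1 / (1 - \<kappa>))" using assms by (intro mult_left_mono) auto
    then show ?thesis by (simp add: sum_distrib_left)
  qed
  ultimately show ?thesis unfolding \<kappa>_def by linarith
qed

context fast_slow
begin

definition euler :: "real \<Rightarrow> real \<Rightarrow> real" where "euler \<rho> x = x + \<rho> * u x"

definition euler_deriv :: "real \<Rightarrow> nat \<Rightarrow> real \<Rightarrow> real" where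
  "euler_deriv \<rho> n x = (\<Prod>i<n. 1 + \<rho> * p ((euler \<rho> ^^ i) x))"

text \<open>Since \<open>u\<close> vanishes at 0 with Lipschitz constant 1, a step with \<rho> \<le>
  1 moves towards 0 without crossing it.\<close>

lemma euler_nonneg:
  assumes "0 \<le> x" "x \<le> b" "0 \<le> \<rho>" "\<rho> \<le> 1"
  shows "0 \<le> euler \<rho> x" "euler \<rho> x \<le> x"
proof -
  have "u x \<le> 0" using u_neg[of x] u_zero assms by (cases "x = 0") auto
  moreover have "- u x \<le> x" using u_Lipschitz[of x 0] u_zero assms by simp
  ultimately have "\<rho> * - u x \<le> x" "\<rho> * u x \<le> 0"
    using assms mult_left_le_one_le[of "- u x" \<rho>] by (auto simp: mult_nonneg_nonpos)
  then show "0 \<le> euler \<rho> x" "euler \<rho> x \<le> x" by (simp_all add: euler_def)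
qed

lemma euler_nonpos:
  assumes "a \<le> x" "x \<le> 0" "0 \<le> \<rho>" "\<rho> \<le> 1"
  shows "euler \<rho> x \<le> 0" "x \<le> euler \<rho> x"
proof -
  have "u x \<ge> 0" using u_pos[of x] u_zero assms by (cases "x = 0") auto
  moreover have "u x \<le> - x" using u_Lipschitz[of x 0] u_zero assms by simp
  ultimately have "\<rho> * u x \<le> - x" "\<rho> * u x \<ge> 0"
    using assms mult_left_le_one_le[of "u x" \<rho>] by auto
  then show "euler \<rho> x \<le> 0" "x \<le> euler \<rho> x" by (simp_all add: euler_def)
qed

lemma euler_mem:
  assumes "x \<in> {a..b}" "0 \<le> \<rho>" "\<rho> \<le> 1"
  shows "euler \<rho> x \<in> {a..b}"
  using euler_nonneg[of x \<rho>] euler_nonpos[of x \<rho>] assms zero_between by (cases "0 \<le> x") auto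

lemma euler_pow_mem:
  assumes "x \<in> {a..b}" "0 \<le> \<rho>" "\<rho> \<le> 1"
  shows "(euler \<rho> ^^ n) x \<in> {a..b}"
  by (induction n) (use assms euler_mem in auto)

text \<open>Orbits of the averaged Euler map are monotone, so the sum of their steps telescopes.\<close>

lemma euler_orbit_length:
  assumes x: "x \<in> {a..b}" and \<rho>: "0 \<le> \<rho>" "\<rho> \<le> 1"
  shows "(\<Sum>i<n. \<rho> * \<bar>u ((euler \<rho> ^^ i) x)\<bar>) \<le> b - a"
proof -
  define z where "z = (\<lambda>i. (euler \<rho> ^^ i) x)"
  have step: "\<rho> * u (z i) = z (Suc i) - z i" for i
    by (simp add: z_def euler_def)
  have mem: "z i \<in> {a..b}" for i
    unfolding z_def by (rule euler_pow_mem[OF x \<rho>])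
  have len: "(\<Sum>i<n. \<rho> * \<bar>u (z i)\<bar>) = (\<Sum>i<n. \<bar>z (Suc i) - z i\<bar>)"
    using \<rho>(1) by (simp add: abs_mult flip: step)
  have "(\<Sum>i<n. \<bar>z (Suc i) - z i\<bar>) \<le> \<bar>z n - z 0\<bar>"
  proof (cases "0 \<le> x")
    case True
    have nn: "0 \<le> z i" for i
    proof (induction i)
      case (Suc i)
      then show ?case using euler_nonneg(1)[of "z i" \<rho>] mem[of i] \<rho> by (simp add: z_def)
    qed (simp add: z_def True)
    have "z (Suc i) \<le> z i" for i
      using euler_nonneg(2)[of "z i" \<rho>] mem[of i] nn[of i] \<rho> by (simp add: z_def)
    then have "(\<Sum>i<n. \<bar>z (Suc i) - z i\<bar>) = (\<Sum>i<n. - (z (Suc i) - z i))"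
      by (intro sum.cong) auto
    also have "\<dots> = - (z n - z 0)" by (simp only: sum_negf sum_lessThan_telescope)
    finally show ?thesis by linarith
  next
    case False
    have np: "z i \<le> 0" for i
    proof (induction i)
      case (Suc i)
      then show ?case using euler_nonpos(1)[of "z i" \<rho>] mem[of i] \<rho> by (simp add: z_def)
    qed (use False in \<open>simp add: z_def\<close>)
    have "z i \<le> z (Suc i)" for i
      using euler_nonpos(2)[of "z i" \<rho>] mem[of i] np[of i] \<rho> by (simp add: z_def)
    then have "(\<Sum>i<n. \<bar>z (Suc i) - z i\<bar>) = (\<Sum>i<n. z (Suc i) - z i)"
      by (intro sum.cong) auto
    also have "\<dots> = z n - z 0" by (rule sum_lessThan_telescope)
    finally show ?thesis by linarith
  qed
  also have "\<dots> \<le> b - a" using mem[of n] mem[of 0] by auto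
  finally show ?thesis using len by (simp add: z_def)
qed

text \<open>Near 0 the Lipschitz bound on \<open>p\<close> keeps it below
  \<open>- \<gamma> / 2\<close>; away from 0 it may be positive, but there
  \<open>\<bar>u\<bar>\<close> is bounded below by compactness. The excess of \<open>p\<close> is
  thus charged to the speed of the orbit, whose total \<open>euler_orbit_length\<close>
  limits.\<close>

lemma drift_bound:
  obtains N where "0 \<le> N" "\<And>x. x \<in> {a..b} \<Longrightarrow> p x + \<gamma> / 2 \<le> N * \<bar>u x\<bar>"
proof -
  define S where "S = {a..b} \<inter> {x. \<gamma> / 2 \<le> \<bar>x\<bar>}"
  have near: "p x + \<gamma> / 2 \<le> 0" if "\<bar>x\<bar> \<le> \<gamma> / 2" for x
    using p_Lipschitz[of x 0] p_zero that by (simp add: abs_le_iff)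
  have "compact S"
    unfolding S_def by (intro compact_Int_closed closed_Collect_le continuous_intros) auto
  have "\<exists>\<eta>>0. \<forall>x\<in>S. \<eta> \<le> \<bar>u x\<bar>"
  proof (cases "S = {}")
    case True
    then show ?thesis by (intro exI[of _ 1]) auto
  next
    case False
    obtain y where y: "y \<in> S" "\<And>x. x \<in> S \<Longrightarrow> \<bar>u y\<bar> \<le> \<bar>u x\<bar>"
      using continuous_attains_inf[OF \<open>compact S\<close> False, of "\<lambda>x. \<bar>u x\<bar>"] continuous_on_u
      by (auto intro: continuous_on_rabs)
    have "u y \<noteq> 0"
      using y(1) avg_zero[of y] \<gamma>_pos by (auto simp: S_def u_def)
    then show ?thesis using y(2) by (intro exI[of _ "\<bar>u y\<bar>"]) auto
  qed
  then obtain \<eta> where \<eta>: "0 < \<eta>" "\<And>x. x \<in> S \<Longrightarrow> \<eta> \<le> \<bar>u x\<bar>" by blast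
  show ?thesis
  proof (rule that[of "(1 + \<gamma> / 2) / \<eta>"])
    show "0 \<le> (1 + \<gamma> / 2) / \<eta>" using \<eta> \<gamma>_pos by simp
    show "p x + \<gamma> / 2 \<le> (1 + \<gamma> / 2) / \<eta> * \<bar>u x\<bar>" if "x \<in> {a..b}" for x
    proof (cases "\<bar>x\<bar> \<le> \<gamma> / 2")
      case True
      then have "p x + \<gamma> / 2 \<le> 0" by (rule near)
      also have "0 \<le> (1 + \<gamma> / 2) / \<eta> * \<bar>u x\<bar>" using \<eta> \<gamma>_pos by simp
      finally show ?thesis .
    next
      case False
      then have "\<eta> \<le> \<bar>u x\<bar>" using that by (intro \<eta>(2)) (auto simp: S_def)
      then have "(1 + \<gamma> / 2) / \<eta> * \<eta> \<le> (1 + \<gamma> / 2) / \<eta> * \<bar>u x\<bar>"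
        using \<eta>(1) \<gamma>_pos by (intro mult_left_mono) auto
      then show ?thesis using p_bound[of x] \<eta>(1) by simp
    qed
  qed
qed

lemma euler_factor_ge:
  assumes "0 \<le> \<rho>" "\<rho> \<le> 1 / 2"
  shows "1 / 2 \<le> 1 + \<rho> * p x"
proof -
  have "\<rho> * - p x \<le> (1 / 2) * 1"
    using assms p_bound[of x] by (intro order_trans[OF mult_left_mono[of "- p x" 1] ]) auto
  then show ?thesis by simp
qed

lemma euler_deriv_pos:
  assumes "0 \<le> \<rho>" "\<rho> \<le> 1 / 2"
  shows "0 < euler_deriv \<rho> n x"
proof -
  have "0 < 1 + \<rho> * p y" for y
    using euler_factor_ge[OF assms, of y] by linarith
  then show ?thesis by (auto simp: euler_deriv_def intro: prod_pos)
qed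

text \<open>By \<open>1 + t \<le> exp t\<close> the product is at most the exponential of a sum.
  There \<open>drift_bound\<close> leaves \<open>- (\<gamma> / 2) * \<rho>\<close> per step and an
  excess of at most \<open>N * (b - a)\<close> in total, which gives the constant
  \<open>exp (N * (b - a))\<close>.\<close>

lemma euler_deriv_bound:
  obtains C where "1 \<le> C"
    "\<And>\<rho> n x. 0 \<le> \<rho> \<Longrightarrow> \<rho> \<le> 1 / 2 \<Longrightarrow> x \<in> {a..b} \<Longrightarrow> euler_deriv \<rho> n x \<le> C * exp (- (\<gamma> / 2) * \<rho>) ^ n"
proof -
  obtain N where N: "0 \<le> N" "\<And>x. x \<in> {a..b} \<Longrightarrow> p x + \<gamma> / 2 \<le> N * \<bar>u x\<bar>"
    using drift_bound by blast
  show ?thesis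
  proof (rule that[of "exp (N * (b - a))"])
    show "1 \<le> exp (N * (b - a))" using N(1) a_less_b by simp
    fix \<rho> x :: real and n :: nat
    assume \<rho>: "0 \<le> \<rho>" "\<rho> \<le> 1 / 2" and x: "x \<in> {a..b}"
    define z where "z = (\<lambda>i. (euler \<rho> ^^ i) x)"
    have mem: "z i \<in> {a..b}" for i
      unfolding z_def using \<rho> by (intro euler_pow_mem[OF x]) auto
    have "euler_deriv \<rho> n x \<le> (\<Prod>i<n. exp (\<rho> * p (z i)))"
      unfolding euler_deriv_def z_def
    proof (rule prod_mono)
      fix i
      show "0 \<le> 1 + \<rho> * p ((euler \<rho> ^^ i) x) \<and> 1 + \<rho> * p ((euler \<rho> ^^ i) x) \<le> exp (\<rho> * p ((euler \<rho> ^^ i) x))"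
        using euler_factor_ge[OF \<rho>, of "(euler \<rho> ^^ i) x"] exp_ge_add_one_self by auto
    qed
    also have "\<dots> = exp (\<Sum>i<n. \<rho> * p (z i))" by (simp add: exp_sum)
    also have "\<dots> \<le> exp (\<Sum>i<n. N * (\<rho> * \<bar>u (z i)\<bar>) - \<gamma> / 2 * \<rho>)"
    proof (subst exp_le_cancel_iff, rule sum_mono)
      fix i
      show "\<rho> * p (z i) \<le> N * (\<rho> * \<bar>u (z i)\<bar>) - \<gamma> / 2 * \<rho>"
        using mult_left_mono[OF N(2)[OF mem[of i]] \<rho>(1)] by (simp add: algebra_simps)
    qed
    also have "(\<Sum>i<n. N * (\<rho> * \<bar>u (z i)\<bar>) - \<gamma> / 2 * \<rho>)
        = N * (\<Sum>i<n. \<rho> * \<bar>u (z i)\<bar>) + real n * (- (\<gamma> / 2) * \<rho>)"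
      by (simp add: sum_subtractf sum_distrib_left)
    also have "exp \<dots> \<le> exp (N * (b - a) + real n * (- (\<gamma> / 2) * \<rho>))"
      using euler_orbit_length[OF x, of \<rho> n] \<rho> N(1) by (auto simp: z_def intro!: mult_left_mono)
    also have "\<dots> = exp (N * (b - a)) * exp (- (\<gamma> / 2) * \<rho>) ^ n"
      by (simp only: exp_add exp_of_nat_mult)
    finally show "euler_deriv \<rho> n x \<le> exp (N * (b - a)) * exp (- (\<gamma> / 2) * \<rho>) ^ n" .
  qed
qed

lemma euler_pow_deriv: "((euler \<rho> ^^ n) has_real_derivative euler_deriv \<rho> n x) (at x)"
proof (induction n)
  case 0
  show ?case by (auto simp: euler_deriv_def id_def intro: DERIV_ident)
next
  case (Suc n)
  have "((\<lambda>y. (euler \<rho> ^^ n) y + \<rho> * u ((euler \<rho> ^^ n) y)) has_real_derivative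
      euler_deriv \<rho> n x + \<rho> * (p ((euler \<rho> ^^ n) x) * euler_deriv \<rho> n x)) (at x)"
    by (intro DERIV_add DERIV_cmult DERIV_chain2[OF u_deriv] Suc)
  moreover have "(\<lambda>y. (euler \<rho> ^^ n) y + \<rho> * u ((euler \<rho> ^^ n) y)) = euler \<rho> ^^ Suc n"
    by (auto simp: euler_def[of \<rho> "(euler \<rho> ^^ n) _"])
  ultimately show ?case by (simp add: euler_deriv_def algebra_simps del: funpow.simps(2))
qed

lemma euler_pow_Lipschitz:
  assumes C: "\<And>z. z \<in> {a..b} \<Longrightarrow> euler_deriv \<rho> n z \<le> C * \<kappa> ^ n"
    and \<rho>: "0 \<le> \<rho>" "\<rho> \<le> 1 / 2" and mem: "x \<in> {a..b}" "y \<in> {a..b}"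
  shows "\<bar>(euler \<rho> ^^ n) x - (euler \<rho> ^^ n) y\<bar> \<le> C * \<kappa> ^ n * \<bar>x - y\<bar>"
  using field_differentiable_bound[of "{a..b}" "euler \<rho> ^^ n" "euler_deriv \<rho> n" "C * \<kappa> ^ n" x y]
    has_field_derivative_at_within[OF euler_pow_deriv] C euler_deriv_pos[OF \<rho>] mem
  by (simp add: abs_of_pos)

text \<open>Logarithms turn the product into a sum whose terms at \<open>x\<close> and
  \<open>y\<close> differ by at most \<open>2 * \<rho>\<close> times the distance of the two orbits.
  These distances decay, so the sum is at most \<open>2 * C * G * \<bar>x - y\<bar>\<close>, and
  undoing the logarithm contributes \<open>C * \<kappa> ^ n\<close>.\<close>

lemma euler_deriv_Lipschitz:
  assumes C: "\<And>n z. z \<in> {a..b} \<Longrightarrow> euler_deriv \<rho> n z \<le> C * \<kappa> ^ n"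
    and \<kappa>: "0 \<le> \<kappa>" "\<And>n. (\<Sum>i<n. \<rho> * \<kappa> ^ i) \<le> G"
    and \<rho>: "0 \<le> \<rho>" "\<rho> \<le> 1 / 2" and mem: "x \<in> {a..b}" "y \<in> {a..b}"
    and "0 \<le> C"
  shows "\<bar>euler_deriv \<rho> n x - euler_deriv \<rho> n y\<bar> \<le> 2 * C\<^sup>2 * G * \<kappa> ^ n * \<bar>x - y\<bar>"
proof -
  have factor: "\<bar>ln (1 + \<rho> * p s) - ln (1 + \<rho> * p t)\<bar> \<le> 2 * (\<rho> * \<bar>s - t\<bar>)" for s t
  proof -
    have fb: "1 / 2 \<le> 1 + \<rho> * p z" for z by (rule euler_factor_ge[OF \<rho>])
    have "norm (ln (1 + \<rho> * p s) - ln (1 + \<rho> * p t)) \<le> 2 * norm ((1 + \<rho> * p s) - (1 + \<rho> * p t))"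
    proof (rule field_differentiable_bound[of "{1 / 2..}" ln "\<lambda>z. 1 / z"])
      show "(ln has_field_derivative 1 / z) (at z within {1 / 2..})" if "z \<in> {1 / 2..}" for z :: real
        using that by (auto intro!: derivative_eq_intros)
      show "norm (1 / z) \<le> 2" if "z \<in> {1 / 2..}" for z :: real
        using that by (auto simp: field_simps)
    qed (use fb in auto)
    also have "\<dots> = 2 * (\<rho> * \<bar>p s - p t\<bar>)" using \<rho> by (simp add: abs_mult flip: right_diff_distrib)
    also have "\<dots> \<le> 2 * (\<rho> * \<bar>s - t\<bar>)" using \<rho> p_Lipschitz by (intro mult_left_mono) auto
    finally show ?thesis by simp
  qed
  have ln_prod: "ln (euler_deriv \<rho> n z) = (\<Sum>i<n. ln (1 + \<rho> * p ((euler \<rho> ^^ i) z)))" for z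
    unfolding euler_deriv_def
  proof (rule ln_prod)
    show "1 + \<rho> * p ((euler \<rho> ^^ i) z) \<noteq> 0" for i
      using euler_factor_ge[OF \<rho>, of "(euler \<rho> ^^ i) z"] by linarith
  qed simp
  have "\<bar>ln (euler_deriv \<rho> n x) - ln (euler_deriv \<rho> n y)\<bar>
      \<le> (\<Sum>i<n. \<bar>ln (1 + \<rho> * p ((euler \<rho> ^^ i) x)) - ln (1 + \<rho> * p ((euler \<rho> ^^ i) y))\<bar>)"
    unfolding ln_prod sum_subtractf[symmetric] by (rule sum_abs)
  also have "\<dots> \<le> (\<Sum>i<n. 2 * (\<rho> * (C * \<kappa> ^ i * \<bar>x - y\<bar>)))"
  proof (rule sum_mono)
    fix i
    have "2 * (\<rho> * \<bar>(euler \<rho> ^^ i) x - (euler \<rho> ^^ i) y\<bar>) \<le> 2 * (\<rho> * (C * \<kappa> ^ i * \<bar>x - y\<bar>))"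
      using euler_pow_Lipschitz[OF C \<rho> mem, of i] \<rho>(1) by (intro mult_left_mono) auto
    then show "\<bar>ln (1 + \<rho> * p ((euler \<rho> ^^ i) x)) - ln (1 + \<rho> * p ((euler \<rho> ^^ i) y))\<bar>
        \<le> 2 * (\<rho> * (C * \<kappa> ^ i * \<bar>x - y\<bar>))"
      using factor by (rule order_trans[rotated])
  qed
  also have "\<dots> = 2 * C * \<bar>x - y\<bar> * (\<Sum>i<n. \<rho> * \<kappa> ^ i)"
    by (simp add: sum_distrib_left algebra_simps)
  also have "\<dots> \<le> 2 * C * \<bar>x - y\<bar> * G"
    using \<open>0 \<le> C\<close> by (intro mult_left_mono \<kappa>) auto
  finally have "C * \<kappa> ^ n * \<bar>ln (euler_deriv \<rho> n x) - ln (euler_deriv \<rho> n y)\<bar>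
      \<le> C * \<kappa> ^ n * (2 * C * \<bar>x - y\<bar> * G)"
    using \<open>0 \<le> C\<close> \<kappa>(1) by (intro mult_left_mono) auto
  then have "\<bar>euler_deriv \<rho> n x - euler_deriv \<rho> n y\<bar> \<le> C * \<kappa> ^ n * (2 * C * \<bar>x - y\<bar> * G)"
    using abs_diff_le_ln_diff[OF euler_deriv_pos[OF \<rho>] euler_deriv_pos[OF \<rho>] C[OF mem(1)] C[OF mem(2)]]
    by (rule order_trans[rotated])
  then show ?thesis by (simp add: power2_eq_square algebra_simps)
qed

section \<open>Weak error of averaging\<close>

lemma weak_error:
  assumes \<rho>: "0 < \<rho>" "\<rho> \<le> 1 / 2" "\<rho> \<le> (\<theta> - 1) / 2"
    and C: "1 \<le> C" "\<And>n z. z \<in> {a..b} \<Longrightarrow> euler_deriv \<rho> n z \<le> C * \<kappa> ^ n"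
    and \<kappa>: "0 \<le> \<kappa>" "\<kappa> \<le> 1" "\<And>n. (\<Sum>i<n. \<rho> * \<kappa> ^ i) \<le> G"
    and x: "x \<in> {a..b}"
    and F_deriv: "\<And>z. (F has_real_derivative F' z) (at z)"
    and F_bound: "\<And>z. z \<in> {a..b} \<Longrightarrow> \<bar>F' z\<bar> \<le> Q"
    and F_Lipschitz: "\<And>z w. z \<in> {a..b} \<Longrightarrow> w \<in> {a..b} \<Longrightarrow> \<bar>F' z - F' w\<bar> \<le> Q * \<bar>z - w\<bar>"
  shows "\<bar>torus_avg (\<lambda>\<psi>. F (slow \<rho> x n \<psi>)) - F ((euler \<rho> ^^ n) x)\<bar>
    \<le> Q * (C + C\<^sup>2 + 2 * C\<^sup>2 * G) * (corr_const + 2) * G * \<rho>"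
proof -
  \<comment> \<open>\<open>L * \<kappa> ^ s\<close> bounds both the size and the Lipschitz constant
    of the derivative of \<open>V s\<close>: \<open>C\<close> serves the size,
    \<open>C\<^sup>2\<close> the variation of \<open>F'\<close> along the iterate, and
    \<open>2 * C\<^sup>2 * G\<close> that of \<open>euler_deriv\<close>.\<close>
  define L where "L = Q * (C + C\<^sup>2 + 2 * C\<^sup>2 * G)"
  define V where "V = (\<lambda>s z. F ((euler \<rho> ^^ s) z))"
  define w where "w = (\<lambda>s z. F' ((euler \<rho> ^^ s) z) * euler_deriv \<rho> s z)"
  define X where "X = slow \<rho> x"
  have \<rho>1: "0 \<le> \<rho>" "\<rho> \<le> 1" using \<rho> by auto
  have Q: "0 \<le> Q" using F_bound[OF x] by linarith
  have G: "0 \<le> G" using \<kappa>(3)[of 0] by simp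
  have L: "0 \<le> L" using Q G C(1) by (simp add: L_def)
  have Emem: "(euler \<rho> ^^ s) z \<in> {a..b}" if "z \<in> {a..b}" for s z
    by (rule euler_pow_mem[OF that \<rho>1])
  have Xmem: "X k \<psi> \<in> {a..b}" for k \<psi>
    unfolding X_def by (rule slow_mem[OF x \<rho>1])
  have Xcont: "continuous_on UNIV (X k)" for k
    unfolding X_def by (rule torus_fun_continuous[OF torus_fun_slow])
  have V_deriv: "(V s has_real_derivative w s z) (at z)" for s z
    unfolding V_def w_def by (rule DERIV_chain2[OF F_deriv euler_pow_deriv])
  have Vcont: "continuous_on S (V s)" for s S
    using V_deriv by (meson DERIV_isCont continuous_at_imp_continuous_on)
  have VXcont: "continuous_on UNIV (\<lambda>\<psi>. V s (h \<psi>))"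
    if "continuous_on UNIV h" for s and h :: "real^2 \<Rightarrow> real"
    by (rule continuous_on_compose2[OF Vcont that]) auto
  have d_abs: "\<bar>euler_deriv \<rho> s z\<bar> \<le> C * \<kappa> ^ s" if "z \<in> {a..b}" for s z
    using C(2)[OF that] euler_deriv_pos[OF \<rho>1(1) \<rho>(2), of s z] by simp
  have w_bound: "\<bar>w s z\<bar> \<le> L * \<kappa> ^ s" if z: "z \<in> {a..b}" for s z
  proof -
    have "\<bar>w s z\<bar> \<le> Q * (C * \<kappa> ^ s)"
      unfolding w_def abs_mult using F_bound[OF Emem[OF z]] d_abs[OF z] Q by (intro mult_mono) auto
    also have "\<dots> = Q * C * \<kappa> ^ s" by simp
    also have "\<dots> \<le> L * \<kappa> ^ s"
      unfolding L_def using Q G \<kappa>(1) by (intro mult_right_mono mult_left_mono) auto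
    finally show ?thesis .
  qed
  have w_Lip: "\<bar>w s z - w s z'\<bar> \<le> L * \<kappa> ^ s * \<bar>z - z'\<bar>" if z: "z \<in> {a..b}" "z' \<in> {a..b}" for s z z'
  proof -
    define e e' where "e = (euler \<rho> ^^ s) z" and "e' = (euler \<rho> ^^ s) z'"
    have "\<bar>F' e - F' e'\<bar> \<le> Q * \<bar>e - e'\<bar>"
      unfolding e_def e'_def by (intro F_Lipschitz Emem z)
    also have "\<dots> \<le> Q * (C * \<kappa> ^ s * \<bar>z - z'\<bar>)"
      unfolding e_def e'_def using euler_pow_Lipschitz[OF C(2) \<rho>1(1) \<rho>(2) z] Q by (intro mult_left_mono) auto
    \<comment> \<open>One of the two decaying factors is given up, so that both parts of the
      estimate decay at the same rate \<open>\<kappa> ^ s\<close>.\<close>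
    also have "\<dots> \<le> Q * (C * 1 * \<bar>z - z'\<bar>)"
      using Q C(1) \<kappa> by (intro mult_left_mono mult_right_mono power_le_one) auto
    finally have "\<bar>(F' e - F' e') * euler_deriv \<rho> s z\<bar> \<le> Q * (C * 1 * \<bar>z - z'\<bar>) * (C * \<kappa> ^ s)"
      unfolding abs_mult using d_abs[OF z(1)] Q C(1) by (intro mult_mono) auto
    moreover have "\<bar>F' e' * (euler_deriv \<rho> s z - euler_deriv \<rho> s z')\<bar> \<le> Q * (2 * C\<^sup>2 * G * \<kappa> ^ s * \<bar>z - z'\<bar>)"
      unfolding abs_mult e'_def
      using F_bound[OF Emem[OF z(2)]] euler_deriv_Lipschitz[OF C(2) \<kappa>(1,3) \<rho>1(1) \<rho>(2) z] C(1) Q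
      by (intro mult_mono) auto
    moreover have "w s z - w s z'
        = (F' e - F' e') * euler_deriv \<rho> s z + F' e' * (euler_deriv \<rho> s z - euler_deriv \<rho> s z')"
      by (simp add: w_def e_def e'_def algebra_simps)
    ultimately have "\<bar>w s z - w s z'\<bar> \<le> Q * (C\<^sup>2 + 2 * C\<^sup>2 * G) * \<kappa> ^ s * \<bar>z - z'\<bar>"
      by (simp add: power2_eq_square algebra_simps)
    also have "\<dots> \<le> L * \<kappa> ^ s * \<bar>z - z'\<bar>"
      unfolding L_def using Q C(1) \<kappa>(1) by (intro mult_right_mono mult_left_mono) auto
    finally show ?thesis .
  qed
  have wcont: "continuous_on {a..b} (w s)" for s
  proof (rule lipschitz_on_continuous_on)
    show "(L * \<kappa> ^ s)-lipschitz_on {a..b} (w s)"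
      using w_Lip L \<kappa>(1) by (auto simp: lipschitz_on_def dist_real_def)
  qed
  have step: "\<bar>torus_avg (\<lambda>\<psi>. V s (X (Suc k) \<psi>)) - torus_avg (\<lambda>\<psi>. V (Suc s) (X k \<psi>))\<bar>
      \<le> L * (corr_const + 2) * \<rho> * (\<rho> * \<kappa> ^ s)" for s k
  proof -
    define g where "g = (\<lambda>\<psi>. w s (X k \<psi>) * (f (X k \<psi>) ((T ^^ k) \<psi>) - u (X k \<psi>)))"
    have gcont: "continuous_on UNIV g"
      unfolding g_def
      by (intro continuous_intros continuous_on_uncurry[OF continuous_f] Xcont continuous_on_T_pow
          continuous_on_compose2[OF wcont] continuous_on_compose2[OF continuous_on_u[of UNIV]])
        (use Xmem in auto)
    have Vdiff: "\<bar>V s (X (Suc k) \<psi>) - V (Suc s) (X k \<psi>) - \<rho> * g \<psi>\<bar> \<le> 2 * (L * \<kappa> ^ s) * \<rho>\<^sup>2" for \<psi>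
    proof -
      define z where "z = X k \<psi>"
      define h where "h = f z ((T ^^ k) \<psi>)"
      have z: "z \<in> {a..b}" unfolding z_def by (rule Xmem)
      have X': "X (Suc k) \<psi> = z + \<rho> * h" by (simp add: X_def z_def h_def)
      have E': "V (Suc s) z = V s (z + \<rho> * u z)"
        by (simp add: V_def euler_def funpow_swap1)
      have mem: "z + \<rho> * h \<in> {a..b}" "z + \<rho> * u z \<in> {a..b}"
        using Xmem[of "Suc k" \<psi>] euler_mem[OF z \<rho>1] by (simp_all add: X' euler_def)
      have taylor: "\<bar>V s (z + \<rho> * y) - V s z - \<rho> * y * w s z\<bar> \<le> L * \<kappa> ^ s * \<rho>\<^sup>2"
        if "z + \<rho> * y \<in> {a..b}" "\<bar>y\<bar> \<le> 1" for y
      proof -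
        have "\<bar>V s (z + \<rho> * y) - V s z - (z + \<rho> * y - z) * w s z\<bar> \<le> L * \<kappa> ^ s * (z + \<rho> * y - z)\<^sup>2"
          by (rule taylor_remainder_Lipschitz[of "{a..b}"])
            (use w_Lip L \<kappa>(1) z that has_field_derivative_at_within[OF V_deriv] in auto)
        also have "\<dots> \<le> L * \<kappa> ^ s * \<rho>\<^sup>2"
          using that(2) L \<kappa>(1) \<rho>(1)
          by (intro mult_left_mono) (auto simp: power_mult_distrib abs_le_square_iff[of y 1, simplified] mult_left_le)
        finally show ?thesis by simp
      qed
      \<comment> \<open>The true and the averaged step start at the same \<open>z\<close>, so
        subtracting their expansions leaves the first-order term \<open>\<rho> * g \<psi>\<close>.
        The two remainders are the source of the 2 in \<open>corr_const + 2\<close>.\<close>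
      have "\<bar>(V s (z + \<rho> * h) - V s z - \<rho> * h * w s z) - (V s (z + \<rho> * u z) - V s z - \<rho> * u z * w s z)\<bar>
          \<le> L * \<kappa> ^ s * \<rho>\<^sup>2 + L * \<kappa> ^ s * \<rho>\<^sup>2"
        using abs_triangle_ineq4 add_mono[OF taylor[OF mem(1)] taylor[OF mem(2)]] f_bound u_bound
        unfolding h_def by (meson order_trans)
      also have "(V s (z + \<rho> * h) - V s z - \<rho> * h * w s z) - (V s (z + \<rho> * u z) - V s z - \<rho> * u z * w s z)
          = V s (X (Suc k) \<psi>) - V (Suc s) (X k \<psi>) - \<rho> * g \<psi>"
        unfolding X' z_def[symmetric] E' by (simp add: g_def z_def[symmetric] h_def algebra_simps)
      finally show ?thesis by (simp add: algebra_simps)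
    qed
    have VS: "continuous_on UNIV (\<lambda>\<psi>. V s (X (Suc k) \<psi>))" "continuous_on UNIV (\<lambda>\<psi>. V (Suc s) (X k \<psi>))"
      by (intro VXcont Xcont)+
    have "\<bar>torus_avg (\<lambda>\<psi>. V s (X (Suc k) \<psi>) - V (Suc s) (X k \<psi>)) - torus_avg (\<lambda>\<psi>. \<rho> * g \<psi>)\<bar>
        \<le> 2 * (L * \<kappa> ^ s) * \<rho>\<^sup>2"
      by (intro torus_avg_abs_diff_le continuous_on_diff VS continuous_on_mult continuous_on_const gcont Vdiff)
    moreover have "\<bar>torus_avg (\<lambda>\<psi>. \<rho> * g \<psi>)\<bar> \<le> \<rho> * (corr_const * (L * \<kappa> ^ s) * \<rho>)"
      unfolding torus_avg_cmult abs_mult g_def X_def abs_of_pos[OF \<rho>(1)]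
      using slow_correlation[OF \<rho>1 \<rho>(3) x w_bound w_Lip] \<rho>(1) by (intro mult_left_mono) auto
    ultimately have "\<bar>torus_avg (\<lambda>\<psi>. V s (X (Suc k) \<psi>) - V (Suc s) (X k \<psi>))\<bar>
        \<le> 2 * (L * \<kappa> ^ s) * \<rho>\<^sup>2 + \<rho> * (corr_const * (L * \<kappa> ^ s) * \<rho>)"
      by linarith
    also have "\<dots> = L * (corr_const + 2) * \<rho> * (\<rho> * \<kappa> ^ s)"
      by (simp add: power2_eq_square algebra_simps)
    finally show ?thesis by (simp add: torus_avg_diff[OF VS])
  qed
  \<comment> \<open>\<open>g k\<close> takes \<open>k\<close> true steps followed by
    \<open>n - k\<close> averaged ones, interpolating between the Euler value and the mean along the
    slow orbit.\<close>
  define g where "g = (\<lambda>k. torus_avg (\<lambda>\<psi>. V (n - k) (X k \<psi>)))"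
  have "g n - g 0 = (\<Sum>k<n. g (Suc k) - g k)"
    by (rule sum_lessThan_telescope[symmetric])
  then have "\<bar>g n - g 0\<bar> \<le> (\<Sum>k<n. \<bar>g (Suc k) - g k\<bar>)" by (simp add: sum_abs)
  also have "\<dots> \<le> (\<Sum>k<n. L * (corr_const + 2) * \<rho> * (\<rho> * \<kappa> ^ (n - Suc k)))"
  proof (rule sum_mono)
    fix k assume "k \<in> {..<n}"
    then have "n - k = Suc (n - Suc k)" by auto
    then show "\<bar>g (Suc k) - g k\<bar> \<le> L * (corr_const + 2) * \<rho> * (\<rho> * \<kappa> ^ (n - Suc k))"
      unfolding g_def using step[of "n - Suc k" k] by simp
  qed
  also have "\<dots> = (\<Sum>k<n. L * (corr_const + 2) * \<rho> * (\<rho> * \<kappa> ^ k))"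
    by (rule sum.nat_diff_reindex)
  also have "\<dots> = L * (corr_const + 2) * \<rho> * (\<Sum>k<n. \<rho> * \<kappa> ^ k)"
    by (simp add: sum_distrib_left)
  also have "\<dots> \<le> L * (corr_const + 2) * \<rho> * G"
    using L corr_const_nonneg \<rho>(1) by (intro mult_left_mono \<kappa>(3)) auto
  finally show ?thesis
    by (simp add: g_def V_def X_def L_def mult_ac)
qed

section \<open>Comparison of the Euler map with the flow\<close>

lemma flow_step:
  assumes y: "\<And>t. 0 \<le> t \<Longrightarrow> (y has_real_derivative u (y t)) (at t within {0..})"
    and "0 \<le> t" "0 \<le> \<rho>"
  shows "\<bar>y (t + \<rho>) - euler \<rho> (y t)\<bar> \<le> \<rho>\<^sup>2"
proof -
  have lip: "\<bar>y s - y s'\<bar> \<le> \<bar>s - s'\<bar>" if "0 \<le> s" "0 \<le> s'" for s s'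
    using field_differentiable_bound[of "{0..}" y "\<lambda>t. u (y t)" 1 s s'] y u_bound that by auto
  have "\<bar>y (t + \<rho>) - y t - (t + \<rho> - t) * u (y t)\<bar> \<le> 1 * (t + \<rho> - t)\<^sup>2"
  proof (rule taylor_remainder_Lipschitz[of "{0..}"])
    show "\<bar>u (y s) - u (y s')\<bar> \<le> 1 * \<bar>s - s'\<bar>" if "s \<in> {0..}" "s' \<in> {0..}" for s s'
      using u_Lipschitz[of "y s" "y s'"] lip[of s s'] that by auto
  qed (use assms in auto)
  then show ?thesis by (simp add: euler_def)
qed

text \<open>For \<rho> below \<open>u a\<close> and \<open>- u b\<close>, the Lipschitz bound on
  \<open>u\<close> keeps the Euler image at distance at least \<rho>^2 from both ends, which is
  exactly the local error in \<open>flow_step\<close>. Confinement at the grid times thus follows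
  from the differential equation.\<close>

lemma flow_mem:
  assumes y: "\<And>t. 0 \<le> t \<Longrightarrow> (y has_real_derivative u (y t)) (at t within {0..})"
    and "y 0 \<in> {a..b}" and \<rho>: "0 < \<rho>" "\<rho> \<le> 1" "\<rho> < u a" "\<rho> < - u b"
  shows "y (real k * \<rho>) \<in> {a..b}"
proof (induction k)
  case 0
  show ?case using assms by simp
next
  case (Suc k)
  define z where "z = y (real k * \<rho>)"
  have step: "\<bar>y (real (Suc k) * \<rho>) - euler \<rho> z\<bar> \<le> \<rho>\<^sup>2"
    using flow_step[OF y, of "real k * \<rho>" \<rho>] \<rho>(1) by (simp add: z_def algebra_simps)
  have z: "a \<le> z" "z \<le> b" using Suc by (auto simp: z_def)
  have "u z \<ge> u a - (z - a)" "u z \<le> u b + (b - z)"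
    using u_Lipschitz[of z a] u_Lipschitz[of z b] z by auto
  then have "\<rho> * u z \<ge> \<rho> * (u a - (z - a))" "\<rho> * u z \<le> \<rho> * (u b + (b - z))"
    using \<rho>(1) by (auto intro: mult_left_mono)
  moreover have "\<rho> * (z - a) \<le> z - a" "\<rho> * (b - z) \<le> b - z"
    using z \<rho> by (auto intro: mult_left_le_one_le)
  moreover have "\<rho>\<^sup>2 \<le> \<rho> * u a" "\<rho>\<^sup>2 \<le> \<rho> * - u b"
    unfolding power2_eq_square using \<rho> by (intro mult_left_mono; simp)+
  ultimately have "euler \<rho> z \<ge> a + \<rho>\<^sup>2" "euler \<rho> z \<le> b - \<rho>\<^sup>2"
    by (auto simp: euler_def algebra_simps)
  then show ?case using step by (auto simp: abs_le_iff)
qed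

text \<open>The local error \<rho>^2 made at step \<open>k\<close> is damped by
  \<open>C * \<kappa> ^ (n - Suc k)\<close> under the remaining Euler steps, so no factor growing
  with time appears.\<close>

lemma flow_euler:
  assumes y: "\<And>t. 0 \<le> t \<Longrightarrow> (y has_real_derivative u (y t)) (at t within {0..})"
    and y0: "y 0 \<in> {a..b}" and \<rho>: "0 < \<rho>" "\<rho> \<le> 1 / 2" "\<rho> < u a" "\<rho> < - u b"
    and C: "0 \<le> C" "\<And>n z. z \<in> {a..b} \<Longrightarrow> euler_deriv \<rho> n z \<le> C * \<kappa> ^ n"
    and \<kappa>: "0 \<le> \<kappa>" "\<And>n. (\<Sum>i<n. \<rho> * \<kappa> ^ i) \<le> G"
  shows "\<bar>y (real n * \<rho>) - (euler \<rho> ^^ n) (y 0)\<bar> \<le> C * G * \<rho>"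
proof -
  define z where "z = (\<lambda>k. y (real k * \<rho>))"
  define g where "g = (\<lambda>k. (euler \<rho> ^^ (n - k)) (z k))"
  have zmem: "z k \<in> {a..b}" for k
    unfolding z_def using flow_mem[OF y y0] \<rho> by simp
  have "g n - g 0 = (\<Sum>k<n. g (Suc k) - g k)"
    by (rule sum_lessThan_telescope[symmetric])
  then have "\<bar>g n - g 0\<bar> \<le> (\<Sum>k<n. \<bar>g (Suc k) - g k\<bar>)" by (simp add: sum_abs)
  also have "\<dots> \<le> (\<Sum>k<n. C * \<rho> * (\<rho> * \<kappa> ^ (n - Suc k)))"
  proof (rule sum_mono)
    fix k assume "k \<in> {..<n}"
    then have "n - k = Suc (n - Suc k)" by auto
    then have "g k = (euler \<rho> ^^ (n - Suc k)) (euler \<rho> (z k))"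
      by (simp only: g_def funpow_Suc_right o_apply)
    then have "\<bar>g (Suc k) - g k\<bar> \<le> C * \<kappa> ^ (n - Suc k) * \<bar>z (Suc k) - euler \<rho> (z k)\<bar>"
      unfolding g_def using euler_mem[OF zmem[of k]] \<rho>
      by (auto intro!: euler_pow_Lipschitz[OF C(2)] zmem)
    also have "\<dots> \<le> C * \<kappa> ^ (n - Suc k) * \<rho>\<^sup>2"
      using flow_step[OF y, of "real k * \<rho>" \<rho>] \<rho>(1) C(1) \<kappa>(1)
      by (intro mult_left_mono) (simp_all add: z_def algebra_simps)
    finally show "\<bar>g (Suc k) - g k\<bar> \<le> C * \<rho> * (\<rho> * \<kappa> ^ (n - Suc k))"
      by (simp add: power2_eq_square mult_ac)
  qed
  also have "\<dots> = (\<Sum>k<n. C * \<rho> * (\<rho> * \<kappa> ^ k))"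
    by (rule sum.nat_diff_reindex)
  also have "\<dots> = C * \<rho> * (\<Sum>k<n. \<rho> * \<kappa> ^ k)"
    by (simp add: sum_distrib_left)
  also have "\<dots> \<le> C * \<rho> * G"
    using C(1) \<rho>(1) by (intro mult_left_mono \<kappa>(2)) auto
  finally show ?thesis by (simp add: g_def z_def mult_ac)
qed

end

section \<open>First and second moments of the deviation from the flow\<close>

context fast_slow
begin

lemma averaging_error:
  "\<exists>\<rho>0>0. \<exists>B. \<forall>\<rho>\<in>{0<..<\<rho>0}. \<forall>n. \<forall>y.
     y 0 \<in> {a..b} \<and> (\<forall>t\<ge>0. (y has_real_derivative u (y t)) (at t within {0..})) \<longrightarrow>
     \<bar>torus_avg (\<lambda>\<psi>. slow \<rho> (y 0) n \<psi> - y (real n * \<rho>))\<bar> \<le> B * \<rho> \<and>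
     torus_avg (\<lambda>\<psi>. (slow \<rho> (y 0) n \<psi> - y (real n * \<rho>))\<^sup>2) \<le> B * \<rho>"
proof -
  define c where "c = \<gamma> / 2"
  have c: "0 < c" using \<gamma>_pos by (simp add: c_def)
  obtain C where C: "1 \<le> C"
    "\<And>\<rho> n x. 0 \<le> \<rho> \<Longrightarrow> \<rho> \<le> 1 / 2 \<Longrightarrow> x \<in> {a..b} \<Longrightarrow> euler_deriv \<rho> n x \<le> C * exp (- c * \<rho>) ^ n"
    using euler_deriv_bound unfolding c_def by blast
  define G where "G = (1 + c) / c"
  define R where "R = \<bar>a\<bar> + \<bar>b\<bar> + 1"
  \<comment> \<open>\<open>2 * R\<close> bounds the derivative of the square and its Lipschitz
    constant on the interval; as \<open>R \<ge> 1\<close>, it also serves the identity.\<close>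
  define W where "W = 2 * R * (C + C\<^sup>2 + 2 * C\<^sup>2 * G) * (corr_const + 2) * G"
  define Z where "Z = C * G"
  \<comment> \<open>In order: Euler factors stay at least 1/2; unstable expansion dominates slow
    growth in \<open>slow_unstable\<close>; the flow stays in the interval at either end.\<close>
  define \<rho>0 where "\<rho>0 = Min {1 / 2, (\<theta> - 1) / 2, u a, - u b}"
  define B where "B = W + Z + 2 * R * W + Z\<^sup>2"
  have G: "0 \<le> G" using c by (simp add: G_def)
  have R: "\<bar>z\<bar> \<le> R" if "z \<in> {a..b}" for z using that by (auto simp: R_def)
  have R1: "1 \<le> R" by (simp add: R_def)
  have WZ: "0 \<le> W" "0 \<le> Z"
    using G R1 C(1) corr_const_nonneg by (auto simp: W_def Z_def intro!: mult_nonneg_nonneg)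
  show ?thesis
  proof (rule exI[of _ \<rho>0], intro exI[of _ B] conjI ballI allI impI)
    show "0 < \<rho>0" using \<theta>_gt u_left u_right by (simp add: \<rho>0_def)
  next
    fix \<rho> n and y :: "real \<Rightarrow> real"
    assume "\<rho> \<in> {0<..<\<rho>0}"
      and asm: "y 0 \<in> {a..b} \<and> (\<forall>t\<ge>0. (y has_real_derivative u (y t)) (at t within {0..}))"
    then have \<rho>: "0 < \<rho>" "\<rho> \<le> 1 / 2" "\<rho> \<le> (\<theta> - 1) / 2" "\<rho> < u a" "\<rho> < - u b"
      by (simp_all add: \<rho>0_def)
    have y0: "y 0 \<in> {a..b}" and y: "\<And>t. 0 \<le> t \<Longrightarrow> (y has_real_derivative u (y t)) (at t within {0..})"
      using asm by auto
    define \<kappa> where "\<kappa> = exp (- c * \<rho>)"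
    have \<kappa>: "0 \<le> \<kappa>" "\<kappa> \<le> 1" using c \<rho>(1) by (simp_all add: \<kappa>_def)
    have sum: "(\<Sum>i<k. \<rho> * \<kappa> ^ i) \<le> G" for k
      unfolding \<kappa>_def G_def using c \<rho> by (intro sum_exp_le) auto
    have CE: "euler_deriv \<rho> k z \<le> C * \<kappa> ^ k" if "z \<in> {a..b}" for k z
      unfolding \<kappa>_def using C(2) \<rho> that by simp
    define X where "X = slow \<rho> (y 0) n"
    define e where "e = (euler \<rho> ^^ n) (y 0)"
    define yn where "yn = y (real n * \<rho>)"
    have Xcont: "continuous_on UNIV X"
      unfolding X_def by (rule torus_fun_continuous[OF torus_fun_slow])
    have 1: "\<bar>torus_avg X - e\<bar> \<le> W * \<rho>"
      unfolding X_def e_def W_def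
      by (rule weak_error[OF \<rho>(1,2,3) C(1) CE \<kappa> sum y0, where F = "\<lambda>z. z" and F' = "\<lambda>z. 1"])
        (use R1 in \<open>auto intro: DERIV_ident\<close>)
    have 2: "\<bar>torus_avg (\<lambda>\<psi>. (X \<psi>)\<^sup>2) - e\<^sup>2\<bar> \<le> W * \<rho>"
      unfolding X_def e_def W_def
    proof (rule weak_error[OF \<rho>(1,2,3) C(1) CE \<kappa> sum y0, where F = "\<lambda>z. z\<^sup>2" and F' = "\<lambda>z. 2 * z"])
      show "((\<lambda>z. z\<^sup>2) has_real_derivative 2 * z) (at z)" for z :: real
        by (auto intro!: derivative_eq_intros)
      show "\<bar>2 * z\<bar> \<le> 2 * R" if "z \<in> {a..b}" for z
        using R[OF that] by (simp only: abs_mult abs_numeral)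
      show "\<bar>2 * z - 2 * w\<bar> \<le> 2 * R * \<bar>z - w\<bar>" for z w
      proof -
        have "2 * z - 2 * w = 2 * (z - w)" by simp
        then have "\<bar>2 * z - 2 * w\<bar> = 2 * (1 * \<bar>z - w\<bar>)" by (simp only: abs_mult abs_numeral mult_1)
        also have "\<dots> \<le> 2 * (R * \<bar>z - w\<bar>)" using R1 by (intro mult_left_mono mult_right_mono) auto
        finally show ?thesis by (simp only: mult.assoc)
      qed
    qed
    have 3: "\<bar>yn - e\<bar> \<le> Z * \<rho>"
      unfolding yn_def e_def Z_def using C(1)
      by (intro flow_euler[OF y y0 \<rho>(1,2,4,5) _ CE \<kappa>(1) sum]) auto
    have yn: "\<bar>yn\<bar> \<le> R"
      unfolding yn_def using \<rho> by (intro R flow_mem[OF y y0]) auto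
    have "torus_avg (\<lambda>\<psi>. X \<psi> - yn) = torus_avg X - yn"
      by (simp add: torus_avg_diff[OF Xcont])
    then have "\<bar>torus_avg (\<lambda>\<psi>. X \<psi> - yn)\<bar> \<le> W * \<rho> + Z * \<rho>"
      using 1 3 by linarith
    also have "\<dots> = (W + Z) * \<rho>" by (simp add: distrib_right)
    also have "\<dots> \<le> B * \<rho>"
      unfolding B_def using WZ R1 \<rho>(1) by (intro mult_right_mono) auto
    finally show "\<bar>torus_avg (\<lambda>\<psi>. slow \<rho> (y 0) n \<psi> - y (real n * \<rho>))\<bar> \<le> B * \<rho>"
      by (simp add: X_def yn_def)
    have "torus_avg (\<lambda>\<psi>. (X \<psi> - yn)\<^sup>2) = torus_avg (\<lambda>\<psi>. ((X \<psi>)\<^sup>2 - 2 * yn * X \<psi>) + yn\<^sup>2)"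
      by (simp add: power2_diff algebra_simps)
    also have "\<dots> = torus_avg (\<lambda>\<psi>. (X \<psi>)\<^sup>2) - 2 * yn * torus_avg X + yn\<^sup>2"
    proof -
      have c2: "continuous_on UNIV (\<lambda>\<psi>. (X \<psi>)\<^sup>2)" and c1: "continuous_on UNIV (\<lambda>\<psi>. 2 * yn * X \<psi>)"
        by (intro continuous_intros Xcont)+
      show ?thesis
        using torus_avg_add[OF continuous_on_diff[OF c2 c1] continuous_on_const]
        by (simp only: torus_avg_diff[OF c2 c1] torus_avg_cmult torus_avg_const)
    qed
    also have "\<dots> = (torus_avg (\<lambda>\<psi>. (X \<psi>)\<^sup>2) - e\<^sup>2) + - (2 * (yn * (torus_avg X - e))) + (yn - e)\<^sup>2"
      by (simp add: power2_eq_square algebra_simps)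
    also have "\<dots> \<le> W * \<rho> + 2 * R * W * \<rho> + Z\<^sup>2 * \<rho>"
    proof (intro add_mono)
      show "torus_avg (\<lambda>\<psi>. (X \<psi>)\<^sup>2) - e\<^sup>2 \<le> W * \<rho>" using 2 by linarith
      have "\<bar>yn * (torus_avg X - e)\<bar> \<le> R * (W * \<rho>)"
        unfolding abs_mult using yn 1 R1 by (intro mult_mono) auto
      then show "- (2 * (yn * (torus_avg X - e))) \<le> 2 * R * W * \<rho>"
        by (simp add: abs_le_iff)
      have "(yn - e)\<^sup>2 \<le> (Z * \<rho>)\<^sup>2"
        using 3 WZ \<rho>(1) by (simp add: abs_le_square_iff[symmetric])
      also have "\<dots> = Z\<^sup>2 * \<rho> * \<rho>" by (simp add: power2_eq_square)
      also have "\<dots> \<le> Z\<^sup>2 * \<rho> * 1" using \<rho> by (intro mult_left_mono) auto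
      finally show "(yn - e)\<^sup>2 \<le> Z\<^sup>2 * \<rho>" by simp
    qed
    also have "\<dots> = (W + 2 * R * W + Z\<^sup>2) * \<rho>" by (simp add: distrib_right)
    also have "\<dots> \<le> B * \<rho>"
      unfolding B_def using WZ \<rho>(1) by (intro mult_right_mono) auto
    finally show "torus_avg (\<lambda>\<psi>. (slow \<rho> (y 0) n \<psi> - y (real n * \<rho>))\<^sup>2) \<le> B * \<rho>"
      by (simp add: X_def yn_def)
  qed
qed

end

section \<open>Regularity of the vector field\<close>

lemma dphi_0: "dphi 0 g = g"
  by (simp add: dphi_def fun_eq_iff)

lemma dphi_has_derivative:
  assumes "Ck_phi k g" "n < k"
  shows "((\<lambda>x. dphi n g x \<psi>) has_real_derivative dphi (Suc n) g x \<psi>) (at x)"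
proof -
  have "(\<lambda>x. dphi n g x \<psi>) differentiable (at x)"
    using assms by (auto simp: Ck_phi_def differentiable_on_def)
  then have "((\<lambda>x. dphi n g x \<psi>) has_real_derivative deriv (\<lambda>x. dphi n g x \<psi>) x) (at x)"
    by (simp add: DERIV_deriv_iff_real_differentiable)
  then show ?thesis by (simp add: dphi_def)
qed

lemma B_norm_bound:
  assumes "B_norm \<alpha> k g \<le> ennreal B" "0 \<le> B" "n \<le> k"
  shows "\<bar>dphi n g x \<psi>\<bar> \<le> B"
proof -
  have "ennreal \<bar>dphi n g x \<psi>\<bar> \<le> sup_nrm (dphi n g)"
    unfolding sup_nrm_def by (rule SUP_upper2[of "(x, \<psi>)"]) auto
  also have "\<dots> \<le> (\<Sum>n\<le>k. sup_nrm (dphi n g))"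
    using assms(3) by (intro member_le_sum) auto
  also have "\<dots> \<le> B_norm \<alpha> k g" by (simp add: B_norm_def)
  also note assms(1)
  finally show ?thesis using assms(2) by simp
qed

text \<open>Dividing by \<alpha> undoes the weight that the norm puts on the seminorms. Equal points
  are treated apart because the supremum ranges over distinct ones.\<close>

lemma B_norm_Hoelder:
  assumes "B_norm \<alpha> k g \<le> ennreal B" "0 \<le> B" "0 < \<alpha>" "n < k"
  shows "\<bar>dphi n g x \<psi> - dphi n g x \<psi>'\<bar> \<le> B / \<alpha> * norm (\<psi> - \<psi>') powr \<alpha>"
proof (cases "\<psi> = \<psi>'")
  case False
  define q where "q = \<bar>dphi n g x \<psi> - dphi n g x \<psi>'\<bar> / norm (\<psi> - \<psi>') powr \<alpha>"
  have "ennreal q \<le> holder_seminorm \<alpha> (dphi n g)"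
    unfolding holder_seminorm_def q_def by (rule SUP_upper2[of "(x, \<psi>', \<psi>)"]) (use False in auto)
  also have "\<dots> \<le> (\<Sum>n<k. holder_seminorm \<alpha> (dphi n g))"
    using assms(4) by (intro member_le_sum) auto
  finally have "ennreal \<alpha> * ennreal q \<le> ennreal \<alpha> * (\<Sum>n<k. holder_seminorm \<alpha> (dphi n g))"
    by (rule mult_left_mono) simp
  also have "\<dots> \<le> B_norm \<alpha> k g" by (simp add: B_norm_def)
  also note assms(1)
  finally have "\<alpha> * q \<le> B"
    using assms(2,3) by (simp add: q_def flip: ennreal_mult)
  then have "q \<le> B / \<alpha>" using assms(3) by (simp add: field_simps)
  then show ?thesis using False by (simp add: q_def field_simps)
qed simp

theorem corollary2p27:
  fixes f :: "real \<Rightarrow> real^2 \<Rightarrow> real"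
    and A\<^sub>0 :: "int^2^2"
    and \<alpha>\<^sub>0 \<phi>\<^sub>m \<phi>\<^sub>M S\<^sub>m S\<^sub>M \<gamma> :: real
    and S :: "real^2 \<Rightarrow> real"
    and \<Phi> :: "real \<Rightarrow> real \<Rightarrow> real"
  assumes "hyperbolic_automorphism A\<^sub>0"
    and "0 < \<alpha>\<^sub>0" and "\<alpha>\<^sub>0 \<le> 1"
    and "f \<in> B_space \<alpha>\<^sub>0 6" and "B_norm \<alpha>\<^sub>0 6 f = 1"
    and "\<phi>\<^sub>m < \<phi>\<^sub>M" and "\<phi>\<^sub>M - \<phi>\<^sub>m < 2 * pi"
    and "\<And>\<psi>. f \<phi>\<^sub>m \<psi> > 0" and "\<And>\<psi>. f \<phi>\<^sub>M \<psi> < 0"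
    and "\<And>\<psi> x. x \<in> {\<phi>\<^sub>m<..<\<phi>\<^sub>M} \<and> f x \<psi> = 0 \<longleftrightarrow> x = S \<psi>"
    and "S\<^sub>m = (INF \<psi>. S \<psi>)" and "S\<^sub>M = (SUP \<psi>. S \<psi>)"
    and "\<gamma> = - (SUP (x, \<psi>) \<in> {S\<^sub>m..S\<^sub>M} \<times> UNIV. dphi 1 f x \<psi>)" and "\<gamma> > 0"
    and "0 \<in> {S\<^sub>m..S\<^sub>M}"
    and "\<And>x. x \<in> {\<phi>\<^sub>m..\<phi>\<^sub>M} \<Longrightarrow> avg_field f x = 0 \<longleftrightarrow> x = 0"
    and "forward_flow_on (avg_field f) {\<phi>\<^sub>m..\<phi>\<^sub>M} \<Phi>"
  shows "\<exists>\<rho>0>0. \<exists>C\<^sub>9. \<forall>\<rho>\<in>{0<..<\<rho>0}. \<forall>n. \<forall>\<phi>\<in>{\<phi>\<^sub>m..\<phi>\<^sub>M}.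
           \<bar>torus_avg (\<lambda>\<psi>. fst ((skew_map f A\<^sub>0 \<rho> ^^ n) (\<phi>, \<psi>)) - \<Phi> (real n * \<rho>) \<phi>)\<bar> \<le> C\<^sub>9 * \<rho> \<and>
           torus_avg (\<lambda>\<psi>. (fst ((skew_map f A\<^sub>0 \<rho> ^^ n) (\<phi>, \<psi>)) - \<Phi> (real n * \<rho>) \<phi>)\<^sup>2) \<le> C\<^sub>9 * \<rho>"
proof -
  define T where "T = (*v) (map_matrix of_int A\<^sub>0 :: real^2^2)"
  obtain Pu Ps l m where split: "torus_splitting T Pu Ps l m"
    using hyperbolic_splitting[OF assms(1)] unfolding T_def by blast
  have Ck: "Ck_phi 6 f" and per: "torus_periodic f"
    using assms(4) by (auto simp: B_space_def)
  have nrm: "B_norm \<alpha>\<^sub>0 6 f \<le> ennreal 1" using assms(5) by simp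
  note bound = B_norm_bound[OF nrm zero_le_one]
  note hoelder = B_norm_Hoelder[OF nrm zero_le_one assms(2)]
  have f1_zero: "dphi 1 f 0 \<psi> \<le> - \<gamma>" for \<psi>
  proof -
    have "bdd_above ((\<lambda>(x, \<psi>). dphi 1 f x \<psi>) ` ({S\<^sub>m..S\<^sub>M} \<times> UNIV))"
      using bound[of 1] by (intro bdd_aboveI[of _ 1]) (auto simp: abs_le_iff)
    then have "(\<lambda>(x, \<psi>). dphi 1 f x \<psi>) (0, \<psi>) \<le> (SUP (x, \<psi>) \<in> {S\<^sub>m..S\<^sub>M} \<times> UNIV. dphi 1 f x \<psi>)"
      using assms(15) by (intro cSUP_upper) auto
    then show ?thesis using assms(13) by simp
  qed
  have "fast_slow T Pu Ps l m f (dphi 1 f) \<alpha>\<^sub>0 (1 / \<alpha>\<^sub>0) \<phi>\<^sub>m \<phi>\<^sub>M \<gamma>"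
  proof (rule fast_slow.intro[OF split fast_slow_axioms.intro])
    show "((\<lambda>x. f x \<psi>) has_real_derivative dphi 1 f x \<psi>) (at x)" for x \<psi>
      using dphi_has_derivative[OF Ck, of 0 \<psi> x] by (simp add: dphi_0)
    show "\<bar>f x \<psi>\<bar> \<le> 1" "\<bar>dphi 1 f x \<psi>\<bar> \<le> 1" for x \<psi>
      using bound[of 0 x \<psi>] bound[of 1 x \<psi>] by (simp_all add: dphi_0)
    show "\<bar>dphi 1 f x \<psi> - dphi 1 f y \<psi>\<bar> \<le> \<bar>x - y\<bar>" for x y \<psi>
      using field_differentiable_bound[of UNIV "\<lambda>x. dphi 1 f x \<psi>" "\<lambda>x. dphi (Suc 1) f x \<psi>" 1 x y]
        dphi_has_derivative[OF Ck, of 1 \<psi>] bound[of "Suc 1"] by simp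
    show "\<bar>f x \<psi> - f x \<psi>'\<bar> \<le> 1 / \<alpha>\<^sub>0 * norm (\<psi> - \<psi>') powr \<alpha>\<^sub>0"
      "\<bar>dphi 1 f x \<psi> - dphi 1 f x \<psi>'\<bar> \<le> 1 / \<alpha>\<^sub>0 * norm (\<psi> - \<psi>') powr \<alpha>\<^sub>0" for x \<psi> \<psi>'
      using hoelder[of 0 x \<psi> \<psi>'] hoelder[of 1 x \<psi> \<psi>'] by (simp_all add: dphi_0)
    show "f x (\<psi> + axis i (2 * pi)) = f x \<psi>" for x \<psi> i
      using per by (simp add: torus_periodic_def)
    show "torus_avg (f x) = 0 \<longleftrightarrow> x = 0" if "x \<in> {\<phi>\<^sub>m..\<phi>\<^sub>M}" for x
      using assms(16)[OF that] by (simp add: avg_field_def)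
  qed (use assms f1_zero in auto)
  then interpret fast_slow T Pu Ps l m f "dphi 1 f" \<alpha>\<^sub>0 "1 / \<alpha>\<^sub>0" \<phi>\<^sub>m \<phi>\<^sub>M \<gamma> .
  \<comment> \<open>The fast component evolves on its own, so the first component is the slow
    recursion driven by \<open>T ^^ n\<close>.\<close>
  have skew: "(skew_map f A\<^sub>0 \<rho> ^^ n) (x, \<psi>) = (slow \<rho> x n \<psi>, (T ^^ n) \<psi>)" for \<rho> n x \<psi>
  proof (induction n)
    case 0
    show ?case by simp
  next
    case (Suc n)
    have "skew_map f A\<^sub>0 \<rho> (z, \<psi>') = (z + \<rho> * f z \<psi>', T \<psi>')" for z \<psi>'
      by (simp add: skew_map_def T_def)
    then show ?case using Suc by simp
  qed
  have u: "u = avg_field f" by (simp add: u_def avg_field_def fun_eq_iff)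
  obtain \<rho>0 B where "\<rho>0 > 0" and B: "\<And>\<rho> n y. \<rho> \<in> {0<..<\<rho>0} \<Longrightarrow> y 0 \<in> {\<phi>\<^sub>m..\<phi>\<^sub>M} \<Longrightarrow>
      \<forall>t\<ge>0. (y has_real_derivative u (y t)) (at t within {0..}) \<Longrightarrow>
      \<bar>torus_avg (\<lambda>\<psi>. slow \<rho> (y 0) n \<psi> - y (real n * \<rho>))\<bar> \<le> B * \<rho> \<and>
      torus_avg (\<lambda>\<psi>. (slow \<rho> (y 0) n \<psi> - y (real n * \<rho>))\<^sup>2) \<le> B * \<rho>"
    using averaging_error by blast
  show ?thesis
  proof (rule exI[of _ \<rho>0], intro exI[of _ B] conjI[OF \<open>\<rho>0 > 0\<close>] ballI allI)
    fix \<rho> n \<phi> assume \<rho>: "\<rho> \<in> {0<..<\<rho>0}" and \<phi>: "\<phi> \<in> {\<phi>\<^sub>m..\<phi>\<^sub>M}"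
    have "\<Phi> 0 \<phi> = \<phi>"
      "\<forall>t\<ge>0. ((\<lambda>s. \<Phi> s \<phi>) has_real_derivative u (\<Phi> t \<phi>)) (at t within {0..})"
      using assms(17) \<phi> by (auto simp: forward_flow_on_def u)
    then show "\<bar>torus_avg (\<lambda>\<psi>. fst ((skew_map f A\<^sub>0 \<rho> ^^ n) (\<phi>, \<psi>)) - \<Phi> (real n * \<rho>) \<phi>)\<bar> \<le> B * \<rho> \<and>
        torus_avg (\<lambda>\<psi>. (fst ((skew_map f A\<^sub>0 \<rho> ^^ n) (\<phi>, \<psi>)) - \<Phi> (real n * \<rho>) \<phi>)\<^sup>2) \<le> B * \<rho>"
      using B[OF \<rho>, of "\<lambda>s. \<Phi> s \<phi>" n] \<phi> by (simp add: skew)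
  qed
qed

end
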